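(* Let $k$ be a field of characteristic $2$, let $s,t$ be algebraically independent over $k$, and let $\mathfrak G(x)=x^2+sx+t$. Then $$\lim_{n\to\infty}\mathrm{FPP}\big(\operatorname{Gal}(\mathfrak G^n(x)/k(s,t))\big)=\frac13.$$
   Context: $\mathfrak G^n$ is $n$-fold composition; $\operatorname{Gal}(\mathfrak G^n(x)/k(s,t))$ is the Galois group of its splitting field over $k(s,t)$, acting on the roots of $\mathfrak G^n(x)$. For such a group $G$, $\mathrm{FPP}(G)$ is the proportion of elements of $G$ that fix at least one root of $\mathfrak G^n(x)$. *)

theory Defs
  imports "HOL-Algebra.Algebraic_Closure_Type" "HOL-Computational_Algebra.Fraction_Field"
begin

text \<open>The rational function field k(s,t) in two algebraically independent
  variables is modelled as the fraction field of k[s][t] = k poly poly.\<close>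

type_synonym 'k rfun2 = "'k poly poly fract"

definition var_s :: "'k::field rfun2" where
  "var_s = Fract [:[:0, 1:]:] 1"

definition var_t :: "'k::field rfun2" where
  "var_t = Fract [:0, 1:] 1"

definition frakG :: "'k::field rfun2 poly" where
  "frakG = [:var_t, var_s, 1:]"

definition frakG_iter :: "nat \<Rightarrow> 'k::field rfun2 poly" where
  "frakG_iter n = ((\<lambda>p. pcompose frakG p) ^^ n) [:0, 1:]"

definition iter_roots :: "nat \<Rightarrow> 'k::field rfun2 alg_closure set" where
  "iter_roots n = {r. poly (map_poly to_ac (frakG_iter n)) r = 0}"

definition base_autos :: "('a::field alg_closure \<Rightarrow> 'a alg_closure) set" where
  "base_autos = {\<sigma>. bij \<sigma> \<and> (\<forall>x y. \<sigma> (x + y) = \<sigma> x + \<sigma> y) \<and>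
      (\<forall>x y. \<sigma> (x * y) = \<sigma> x * \<sigma> y) \<and> (\<forall>a. \<sigma> (to_ac a) = to_ac a)}"

text \<open>Galois group of the splitting field of G^n over k(s,t), as a permutation
  group on the roots of G^n: restrictions of base-fixing automorphisms of the
  algebraic closure (these are exactly the automorphisms of the splitting field).\<close>
definition Gal_iter :: "nat \<Rightarrow> ('k::field rfun2 alg_closure \<Rightarrow> 'k rfun2 alg_closure) set" where
  "Gal_iter n = (\<lambda>\<sigma>. restrict \<sigma> (iter_roots n)) ` base_autos"

definition FPP :: "('a \<Rightarrow> 'a) set \<Rightarrow> 'a set \<Rightarrow> real" where
  "FPP G R = real (card {g \<in> G. \<exists>r \<in> R. g r = r}) / real (card G)"

end

theory Submission
  imports Defs "HOL-Computational_Algebra.Polynomial_Factorial"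
begin

text \<open>In characteristic 2 the map \<open>G(x) = L(x) + t\<close> is affine over the additive map
  \<open>L(x) = x\<^sup>2 + s x\<close>. The roots of \<open>G\<^sup>n\<close> form a torsor under \<open>W n = ker L\<^sup>n\<close>, a free module of rank one over
  \<open>R = F\<^sub>2[z]/(z\<^sup>n)\<close>, with \<open>z\<close> acting as \<open>L\<close>, so that the Galois group embeds into the maps
  \<open>x \<mapsto> u x + b\<close> with \<open>u \<in> 1 + z R\<close> and \<open>b \<in> R\<close>. It is everything: the generators of \<open>W n\<close> are the roots of
  \<open>L\<^bsup>n-1\<^esup>(x) + s\<close>, which is Eisenstein at \<open>s\<close>, and this remains so over \<open>k(s,v)\<close> for a root \<open>v\<close> of
  \<open>G\<close>; as \<open>v\<close> is not in \<open>k(s,t)\<close>, some automorphism fixes \<open>W n\<close> and moves \<open>v\<close>, and it generates all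
  translations as a module. Finally \<open>x \<mapsto> u x + b\<close> has a fixed point iff \<open>b\<close> lies in the submodule
  generated by \<open>u - 1\<close>, and counting such pairs gives the proportion \<open>1/3 + 1/(6 \<cdot> 4\<^bsup>n-1\<^esup>)\<close>.\<close>

section \<open>Extending homomorphisms to the algebraic closure\<close>

locale ring_map =
  fixes h :: "'a::comm_ring_1 \<Rightarrow> 'b::comm_ring_1"
  assumes map_one [simp]: "h 1 = 1"
    and map_add [simp]: "h (x + y) = h x + h y"
    and map_mult [simp]: "h (x * y) = h x * h y"
begin

lemma map_zero [simp]: "h 0 = 0"
  using map_add[of 0 0] by (simp del: map_add)

lemma map_uminus [simp]: "h (- x) = - h x"
  using map_add[of x "- x"] by (simp del: map_add add: eq_neg_iff_add_eq_0 add.commute)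

lemma map_diff [simp]: "h (x - y) = h x - h y"
  using map_add[of x "- y"] by (simp del: map_add)

lemma map_power [simp]: "h (x ^ n) = h x ^ n"
  by (induction n) auto

lemma map_sum: "h (sum f A) = (\<Sum>x\<in>A. h (f x))"
  by (induction A rule: infinite_finite_induct) auto

lemma map_poly_add: "map_poly h (p + q) = map_poly h p + map_poly h q"
  by (intro poly_eqI) (simp add: coeff_map_poly)

lemma map_poly_mult: "map_poly h (p * q) = map_poly h p * map_poly h q"
  by (intro poly_eqI) (simp add: coeff_map_poly coeff_mult map_sum)

lemma poly_map_poly_pcompose:
  "poly (map_poly h (pcompose p q)) x = poly (map_poly h p) (poly (map_poly h q) x)"
  by (induction p) (auto simp: map_poly_pCons pcompose_pCons map_poly_add map_poly_mult)

end

lemma ring_map_inj: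
  fixes h :: "'a::field \<Rightarrow> 'b::comm_ring_1"
  assumes "ring_map h"
  shows "inj h"
proof (rule injI)
  interpret ring_map h by fact
  fix x y assume "h x = h y"
  then have "h (x - y) = 0" by simp
  show "x = y"
  proof (rule ccontr)
    assume "x \<noteq> y"
    then have "h ((x - y) * inverse (x - y)) = 1" by simp
    with \<open>h (x - y) = 0\<close> show False
      by (metis map_mult mult_zero_left zero_neq_one)
  qed
qed

lemma ring_map_comp: "ring_map f \<Longrightarrow> ring_map g \<Longrightarrow> ring_map (f \<circ> g)"
  by (simp add: ring_map_def)

lemma ring_map_to_ac: "ring_map to_ac"
  by (simp add: ring_map_def)

interpretation to_ac: ring_map to_ac
  by (rule ring_map_to_ac)

text \<open>A partial homomorphism on a subring of the algebraic closure is represented by its graph,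
  which turns the union of a chain into a plain set union.\<close>

definition partial_hom ::
    "('a::field \<Rightarrow> 'a alg_closure) \<Rightarrow> ('a alg_closure \<times> 'a alg_closure) set \<Rightarrow> bool" where
  "partial_hom \<psi> M \<longleftrightarrow> (\<forall>a. (to_ac a, \<psi> a) \<in> M) \<and>
     (\<forall>x y x' y'. (x, y) \<in> M \<longrightarrow> (x', y') \<in> M \<longrightarrow> (x + x', y + y') \<in> M \<and> (x * x', y * y') \<in> M) \<and>
     (\<forall>x y y'. (x, y) \<in> M \<longrightarrow> (x, y') \<in> M \<longrightarrow> y = y')"

text \<open>Stands for "\<open>g\<close> is the image of \<open>f\<close> under the partial
  homomorphism \<open>M\<close>", coefficient by coefficient, since \<open>M\<close> is only a
  relation.\<close>

definition related_polys :: "('a::zero \<times> 'b::zero) set \<Rightarrow> 'a poly \<Rightarrow> 'b poly \<Rightarrow> bool" where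
  "related_polys M f g \<longleftrightarrow> (\<forall>i. (coeff f i, coeff g i) \<in> M)"

context
  fixes \<psi> :: "'a::field \<Rightarrow> 'a alg_closure" and M
  assumes psi: "ring_map \<psi>" and M: "partial_hom \<psi> M"
begin

interpretation psi: ring_map \<psi> by (rule psi)

lemma ph_base: "(to_ac a, \<psi> a) \<in> M"
  and ph_add: "(x, y) \<in> M \<Longrightarrow> (x', y') \<in> M \<Longrightarrow> (x + x', y + y') \<in> M"
  and ph_mult: "(x, y) \<in> M \<Longrightarrow> (x', y') \<in> M \<Longrightarrow> (x * x', y * y') \<in> M"
  and ph_unique: "(x, y) \<in> M \<Longrightarrow> (x, y') \<in> M \<Longrightarrow> y = y'"
  using M unfolding partial_hom_def by blast+

lemma ph_0: "(0, 0) \<in> M" and ph_1: "(1, 1) \<in> M"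
  using ph_base[of 0] ph_base[of 1] by auto

lemma ph_uminus: "(x, y) \<in> M \<Longrightarrow> (- x, - y) \<in> M"
  using ph_mult[OF ph_base[of "- 1"]] by fastforce

lemma ph_sum: "(\<And>i. i \<in> I \<Longrightarrow> (f i, g i) \<in> M) \<Longrightarrow> (sum f I, sum g I) \<in> M"
  by (induction I rule: infinite_finite_induct) (auto intro: ph_0 ph_add)

lemma related_add:
  "related_polys M f g \<Longrightarrow> related_polys M f' g' \<Longrightarrow> related_polys M (f + f') (g + g')"
  by (simp add: related_polys_def ph_add)

lemma related_uminus: "related_polys M f g \<Longrightarrow> related_polys M (- f) (- g)"
  by (simp add: related_polys_def ph_uminus)

lemma related_mult:
  "related_polys M f g \<Longrightarrow> related_polys M f' g' \<Longrightarrow> related_polys M (f * f') (g * g')"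
  by (auto simp: related_polys_def coeff_mult intro!: ph_sum ph_mult)

lemma related_monom: "(x, y) \<in> M \<Longrightarrow> related_polys M (monom x k) (monom y k)"
  by (simp add: related_polys_def ph_0)

lemma related_const: "(x, y) \<in> M \<Longrightarrow> related_polys M [:x:] [:y:]"
  using related_monom[of x y 0] by (simp add: monom_0)

lemma related_base: "related_polys M (map_poly to_ac p) (map_poly \<psi> p)"
  by (simp add: related_polys_def coeff_map_poly ph_base)

lemma related_zero:
  assumes "related_polys M 0 g"
  shows "g = 0"
proof (rule poly_eqI)
  fix i
  have "(0, coeff g i) \<in> M" using assms by (simp add: related_polys_def)
  then show "coeff g i = coeff 0 i" using ph_unique[OF _ ph_0] by simp
qed

lemma related_poly: "related_polys M f g \<Longrightarrow> (x, y) \<in> M \<Longrightarrow> (poly f x, poly g y) \<in> M"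
proof (induction f arbitrary: g)
  case 0
  then have "g = 0" using related_zero by blast
  then show ?case by (simp add: ph_0)
next
  case (pCons a f)
  obtain b g' where g: "g = pCons b g'" by (cases g)
  have ab: "(a, b) \<in> M"
    using pCons.prems(1) unfolding related_polys_def g by (metis coeff_pCons_0)
  have "related_polys M f g'"
    using pCons.prems(1) unfolding related_polys_def g by (metis coeff_pCons_Suc)
  then have "(poly f x, poly g' y) \<in> M"
    using pCons by blast
  then show ?case
    using ab pCons.prems(2) by (simp add: g ph_add ph_mult)
qed

text \<open>The domain is automatically a field, as its elements are algebraic over the base field.\<close>

lemma ph_inverse:
  assumes "(x, y) \<in> M" "x \<noteq> 0"
  shows "y \<noteq> 0" "(inverse x, inverse y) \<in> M"
proof -
  obtain p :: "'a poly" where p: "p \<noteq> 0" "poly (map_poly to_ac p) x = 0"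
    by (rule alg_closure_algebraic)
  \<comment> \<open>A zero constant term of \<open>p\<close> is divided out by \<open>x\<close>;
    once it is nonzero, the equation expresses the inverse of \<open>x\<close> as a polynomial in
    \<open>x\<close> over the base field.\<close>
  have "\<exists>y'. (inverse x, y') \<in> M"
    using p
  proof (induction p)
    case (pCons a p)
    show ?case
    proof (cases "a = 0")
      case True
      then have "poly (map_poly to_ac p) x = 0"
        using pCons.prems assms(2) by (simp add: map_poly_pCons)
      moreover have "p \<noteq> 0" using pCons.hyps True by auto
      ultimately show ?thesis using pCons.IH by blast
    next
      case False
      have "to_ac a + x * poly (map_poly to_ac p) x = 0"
        using pCons.prems by (simp add: map_poly_pCons)
      then have "x * poly (map_poly to_ac p) x = to_ac (- a)"
        by (simp only: to_ac_minus add_eq_0_iff)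
      then have "x * (poly (map_poly to_ac p) x * to_ac (inverse (- a))) = 1"
        using False by (simp add: mult.assoc[symmetric])
      then have "inverse x = poly (map_poly to_ac p) x * to_ac (inverse (- a))"
        by (rule inverse_unique)
      moreover have "(poly (map_poly to_ac p) x * to_ac (inverse (- a)),
          poly (map_poly \<psi> p) y * \<psi> (inverse (- a))) \<in> M"
        by (intro ph_mult related_poly related_base ph_base assms)
      ultimately show ?thesis by metis
    qed
  qed auto
  then obtain y' where y': "(inverse x, y') \<in> M" by blast
  have "(1, y * y') \<in> M"
    using ph_mult[OF assms(1) y'] assms(2) by simp
  then have "y * y' = 1" using ph_1 ph_unique by blast
  then show "y \<noteq> 0" "(inverse x, inverse y) \<in> M"
    using y' inverse_unique by auto
qed

text \<open>The new domain consists of the values \<open>poly f a\<close> with \<open>f\<close> over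
  the old one. Applied to a difference, the hypothesis says that \<open>poly g b\<close> does not
  depend on the chosen representation.\<close>

lemma ph_adjoin:
  assumes root: "\<And>f g. related_polys M f g \<Longrightarrow> poly f a = 0 \<Longrightarrow> poly g b = 0"
  obtains M' where "partial_hom \<psi> M'" "M \<subseteq> M'" "(a, b) \<in> M'"
proof
  define M' where "M' = {(poly f a, poly g b) | f g. related_polys M f g}"
  show sub: "M \<subseteq> M'"
  proof
    fix z assume "z \<in> M"
    obtain x y where z: "z = (x, y)" by (cases z)
    show "z \<in> M'"
      unfolding M'_def using related_const[of x y] \<open>z \<in> M\<close> z
      by (intro CollectI exI[of _ "[:x:]"] exI[of _ "[:y:]"]) auto
  qed
  have "related_polys M [:0, 1:] [:0, 1:]"
    using related_monom[OF ph_1, of 1] by (simp add: monom_altdef)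
  then show "(a, b) \<in> M'"
    unfolding M'_def by (intro CollectI exI[of _ "[:0, 1:]"]) auto
  show "partial_hom \<psi> M'"
    unfolding partial_hom_def
  proof (intro conjI allI impI)
    show "(to_ac c, \<psi> c) \<in> M'" for c using ph_base sub by auto
  next
    fix x y x' y' assume "(x, y) \<in> M'" "(x', y') \<in> M'"
    then obtain f g f' g' where *: "related_polys M f g" "related_polys M f' g'"
      "x = poly f a" "y = poly g b" "x' = poly f' a" "y' = poly g' b"
      unfolding M'_def by blast
    show "(x + x', y + y') \<in> M'" "(x * x', y * y') \<in> M'"
      unfolding M'_def *(3-6) poly_add[symmetric] poly_mult[symmetric]
      using related_add[OF *(1,2)] related_mult[OF *(1,2)] by blast+
  next
    fix x y y' assume "(x, y) \<in> M'" "(x, y') \<in> M'"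
    then obtain f g f' g' where *: "related_polys M f g" "related_polys M f' g'"
      "x = poly f a" "y = poly g b" "x = poly f' a" "y' = poly g' b"
      unfolding M'_def by blast
    have "poly (f + - f') a = 0" using * by simp
    then have "poly (g + - g') b = 0"
      using related_add[OF *(1) related_uminus[OF *(2)]] root by blast
    then show "y = y'" using * by simp
  qed
qed

text \<open>Take \<open>p\<close> of least degree over the domain of \<open>M\<close> with root
  \<open>a\<close>, and let \<open>b\<close> be a root of its image \<open>q\<close>. Division by
  \<open>p\<close> shows that every relation satisfied by \<open>a\<close> carries over to
  \<open>b\<close>.\<close>

lemma ph_adjoin_elem:
  obtains b M' where "partial_hom \<psi> M'" "M \<subseteq> M'" "(a, b) \<in> M'"
proof -
  define Q where "Q = (\<lambda>d. \<exists>f g. related_polys M f g \<and> f \<noteq> 0 \<and> poly f a = 0 \<and> degree f = d)"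
  obtain p0 :: "'a poly" where p0: "p0 \<noteq> 0" "poly (map_poly to_ac p0) a = 0"
    by (rule alg_closure_algebraic)
  have "Q (degree (map_poly to_ac p0))"
    unfolding Q_def using related_base[of p0] p0 by (auto simp: map_poly_eq_0_iff)
  then have QL: "Q (LEAST d. Q d)" by (rule LeastI)
  then obtain p q where pq: "related_polys M p q" "p \<noteq> 0" "poly p a = 0"
      and deg: "degree p = (LEAST d. Q d)"
    unfolding Q_def by blast
  have least: "degree p \<le> degree f" if "related_polys M f g" "f \<noteq> 0" "poly f a = 0" for f g
    unfolding deg using that by (intro Least_le) (auto simp: Q_def)
  have lead: "(lead_coeff p, coeff q (degree p)) \<in> M"
    using pq by (simp add: related_polys_def)
  \<comment> \<open>Nonzero elements have nonzero images, so \<open>q\<close> is not constant and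
    has a root.\<close>
  have q_lead: "coeff q (degree p) \<noteq> 0"
    using ph_inverse(1)[OF lead] pq by simp
  have "degree p > 0"
    using pq(2,3) by (metis degree_eq_zeroE gr0I pCons_0_0 poly_const_conv)
  then have "degree q > 0" using q_lead le_degree by fastforce
  then obtain b where b: "poly q b = 0" using alg_closed_imp_poly_has_root by blast
  have "poly g b = 0" if "related_polys M f g" "poly f a = 0" for f g
    using that
  \<comment> \<open>The measure puts the zero polynomial below the nonzero constants, so that each
    division step decreases it.\<close>
  proof (induction "if f = 0 then 0 else Suc (degree f)" arbitrary: f g rule: less_induct)
    case less
    show ?case
    proof (cases "f = 0")
      case True
      then have "g = 0" using less.prems(1) related_zero by blast
      then show ?thesis by simp
    next
      case False
      define k where "k = degree f - degree p"
      define c where "c = lead_coeff f * inverse (lead_coeff p)"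
      define d where "d = coeff g (degree f) * inverse (coeff q (degree p))"
      have le: "degree p \<le> degree f" using least less.prems False by blast
      have cd: "(c, d) \<in> M"
        unfolding c_def d_def using less.prems(1) ph_inverse(2)[OF lead] pq(2)
        by (intro ph_mult) (auto simp: related_polys_def)
      define f' where "f' = f + - (monom c k * p)"
      define g' where "g' = g + - (monom d k * q)"
      have rel: "related_polys M f' g'"
        unfolding f'_def g'_def
        by (intro related_add related_uminus related_mult related_monom cd less.prems pq)
      have "c \<noteq> 0" using False pq(2) by (simp add: c_def)
      have "f' \<noteq> 0 \<Longrightarrow> degree f' < degree f"
      proof -
        assume "f' \<noteq> 0"
        have "degree (monom c k * p) = degree f"
          using \<open>c \<noteq> 0\<close> pq(2) le by (simp add: degree_mult_eq degree_monom_eq k_def)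
        then have 1: "degree f' \<le> degree f"
          unfolding f'_def by (intro degree_add_le) auto
        have "coeff f' (degree f) = 0"
          unfolding f'_def using le pq(2) by (simp add: coeff_monom_mult k_def c_def)
        with 1 \<open>f' \<noteq> 0\<close> show ?thesis
          by (metis leading_coeff_0_iff le_neq_implies_less)
      qed
      moreover have "poly f' a = 0" using less.prems pq by (simp add: f'_def)
      ultimately have "poly g' b = 0"
        using less.hyps[of f' g'] rel False by (cases "f' = 0") auto
      then show ?thesis using b by (simp add: g'_def)
    qed
  qed
  then show thesis using ph_adjoin that by metis
qed

end

text \<open>Zorn's lemma gives a maximal partial homomorphism; it is total, because any missing
  element could still be adjoined.\<close>

lemma partial_hom_extend:
  assumes psi: "ring_map \<psi>" and M0: "partial_hom \<psi> M0"
  obtains \<Phi> where "ring_map \<Phi>" "\<forall>(x, y)\<in>M0. \<Phi> x = y"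
proof -
  define F where "F = {M. partial_hom \<psi> M \<and> M0 \<subseteq> M}"
  have "\<exists>M\<in>F. \<forall>N\<in>F. M \<subseteq> N \<longrightarrow> N = M"
  proof (rule subset_Zorn_nonempty)
    have "M0 \<in> F" using M0 by (simp add: F_def)
    then show "F \<noteq> {}" by blast
  next
    fix Ch assume ne: "Ch \<noteq> {}" and ch: "subset.chain F Ch"
    have C: "partial_hom \<psi> N" "M0 \<subseteq> N" if "N \<in> Ch" for N
      using that ch by (auto simp: subset.chain_def F_def)
    have two: "\<exists>N\<in>Ch. z \<in> N \<and> z' \<in> N" if "z \<in> \<Union> Ch" "z' \<in> \<Union> Ch" for z z'
      using that ch unfolding subset.chain_def by blast
    have "partial_hom \<psi> (\<Union> Ch)"
      unfolding partial_hom_def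
    proof (intro conjI allI impI)
      show "(to_ac a, \<psi> a) \<in> \<Union> Ch" for a
        using ne C(1) unfolding partial_hom_def by blast
    next
      fix x y x' y' assume "(x, y) \<in> \<Union> Ch" "(x', y') \<in> \<Union> Ch"
      then obtain N where "N \<in> Ch" "(x, y) \<in> N" "(x', y') \<in> N" using two by blast
      then show "(x + x', y + y') \<in> \<Union> Ch" "(x * x', y * y') \<in> \<Union> Ch"
        using C(1)[of N] unfolding partial_hom_def by blast+
    next
      fix x y y' assume "(x, y) \<in> \<Union> Ch" "(x, y') \<in> \<Union> Ch"
      then obtain N where "N \<in> Ch" "(x, y) \<in> N" "(x, y') \<in> N" using two by blast
      then show "y = y'" using C(1)[of N] unfolding partial_hom_def by blast
    qed
    then show "\<Union> Ch \<in> F" using ne C(2) by (auto simp: F_def)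
  qed
  then obtain M where MF: "M \<in> F" and maximal: "\<forall>N\<in>F. M \<subseteq> N \<longrightarrow> N = M" ..
  from MF have M: "partial_hom \<psi> M" "M0 \<subseteq> M" by (simp_all add: F_def)
  have max: "N = M" if "partial_hom \<psi> N" "M \<subseteq> N" for N
    using maximal that M(2) unfolding F_def by simp
  have total: "\<exists>y. (x, y) \<in> M" for x
  proof -
    obtain b M' where "partial_hom \<psi> M'" "M \<subseteq> M'" "(x, b) \<in> M'"
      using ph_adjoin_elem[OF psi M(1)] by metis
    then show ?thesis using max[of M'] by auto
  qed
  then obtain \<Phi> where \<Phi>: "\<And>x. (x, \<Phi> x) \<in> M" by metis
  have eq: "\<Phi> x = y" if "(x, y) \<in> M" for x y
    using ph_unique[OF psi M(1) \<Phi> that] .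
  have "ring_map \<Phi>"
    by unfold_locales
      (auto intro!: eq ph_1[OF psi M(1)] ph_add[OF psi M(1)] ph_mult[OF psi M(1)] \<Phi>)
  with eq M(2) that show thesis by blast
qed

lemma ring_map_alg_closure_extend:
  fixes \<psi> :: "'a::field \<Rightarrow> 'a alg_closure"
  assumes "ring_map \<psi>"
  obtains \<Phi> where "ring_map \<Phi>" "\<forall>a. \<Phi> (to_ac a) = \<psi> a"
proof -
  interpret ring_map \<psi> by fact
  have ph: "partial_hom \<psi> (range (\<lambda>a. (to_ac a, \<psi> a)))"
    unfolding partial_hom_def by (auto simp flip: to_ac_add to_ac_mult map_add map_mult)
  obtain \<Phi> where "ring_map \<Phi>"
      "\<forall>(x, y)\<in>range (\<lambda>a. (to_ac a, \<psi> a)). \<Phi> x = y"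
    by (rule partial_hom_extend[OF assms ph])
  then show thesis by (intro that) auto
qed

text \<open>A polynomial over the base field with root \<open>y\<close> is the image under
  \<open>\<Phi>\<close> of some \<open>q\<close>. As \<open>q\<close> splits into linear factors,
  \<open>y\<close> is the image of one of its roots.\<close>

lemma ring_map_alg_closure_surj:
  fixes \<Phi> :: "'a::field alg_closure \<Rightarrow> 'a alg_closure"
  assumes "ring_map \<Phi>" "range to_ac \<subseteq> range \<Phi>"
  shows "surj \<Phi>"
proof -
  interpret ring_map \<Phi> by fact
  have "y \<in> range \<Phi>" for y
  proof -
    obtain p :: "'a poly" where p: "p \<noteq> 0" "poly (map_poly to_ac p) y = 0"
      by (rule alg_closure_algebraic)
    have inj: "inj \<Phi>" by (rule ring_map_inj) fact
    define q where "q = map_poly (inv_into UNIV \<Phi> \<circ> to_ac) p"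
    have inv0: "inv_into UNIV \<Phi> 0 = 0" using inj by (metis inv_f_f map_zero)
    have "map_poly \<Phi> q = map_poly to_ac p"
      unfolding q_def
      by (intro poly_eqI) (use assms(2) inv0 in \<open>auto simp: coeff_map_poly f_inv_into_f range_subsetD\<close>)
    moreover have "q \<noteq> 0" using p(1) \<open>map_poly \<Phi> q = map_poly to_ac p\<close>
      by (auto simp: map_poly_eq_0_iff)
    then obtain A where "q = smult (lead_coeff q) (\<Prod>x\<in>#A. [:-x, 1:])"
      using alg_closed_imp_factorization by blast
    ultimately have "poly (map_poly \<Phi> (smult (lead_coeff q) (\<Prod>x\<in>#A. [:-x, 1:]))) y = 0"
      using p(2) by simp
    moreover have "poly (map_poly \<Phi> (\<Prod>x\<in>#A. [:-x, 1:])) y = (\<Prod>x\<in>#A. y - \<Phi> x)"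
      by (induction A) (simp_all add: map_poly_mult map_poly_pCons del: mult_pCons_left)
    moreover have "\<Phi> (lead_coeff q) \<noteq> 0"
      using \<open>q \<noteq> 0\<close> inj by (metis leading_coeff_0_iff map_zero inj_eq)
    ultimately have "(\<Prod>x\<in>#A. y - \<Phi> x) = 0"
      by (simp add: map_poly_smult)
    then show ?thesis by auto
  qed
  then show ?thesis by blast
qed

section \<open>Automorphisms over the base field and conjugate elements\<close>

lemma base_autosI:
  assumes "ring_map \<sigma>" "\<And>a. \<sigma> (to_ac a) = to_ac a"
  shows "\<sigma> \<in> base_autos"
proof -
  have "range to_ac \<subseteq> range \<sigma>" using assms(2) by (metis image_subsetI rangeI)
  then have "bij \<sigma>"
    using ring_map_inj[OF assms(1)] ring_map_alg_closure_surj[OF assms(1)] by (simp add: bij_def)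
  with assms show ?thesis by (simp add: base_autos_def ring_map_def)
qed

lemma base_autos_ring_map: "\<sigma> \<in> base_autos \<Longrightarrow> ring_map \<sigma>"
  unfolding base_autos_def ring_map_def by (auto, metis to_ac_1)

lemma base_autos_fix: "\<sigma> \<in> base_autos \<Longrightarrow> \<sigma> (to_ac a) = to_ac a"
  by (simp add: base_autos_def)

lemma base_autos_bij: "\<sigma> \<in> base_autos \<Longrightarrow> bij \<sigma>"
  by (simp add: base_autos_def)

lemma base_autos_comp: "\<sigma> \<in> base_autos \<Longrightarrow> \<tau> \<in> base_autos \<Longrightarrow> \<sigma> \<circ> \<tau> \<in> base_autos"
  by (auto simp: base_autos_def intro: bij_comp)

lemma ring_map_inv:
  assumes "ring_map h" "bij h"
  shows "ring_map (inv_into UNIV h)"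
proof -
  interpret ring_map h by fact
  let ?g = "inv_into UNIV h"
  have hg: "h (?g x) = x" for x using assms(2) by (simp add: bij_is_surj surj_f_inv_f)
  have eq: "?g y = x" if "h x = y" for x y using that assms(2) by (simp add: bij_is_inj inv_f_eq)
  show ?thesis
    by unfold_locales (simp_all add: eq hg)
qed

lemma base_autos_inv:
  assumes "\<sigma> \<in> base_autos"
  shows "inv_into UNIV \<sigma> \<in> base_autos"
proof (rule base_autosI)
  show "ring_map (inv_into UNIV \<sigma>)"
    using ring_map_inv base_autos_ring_map base_autos_bij assms by blast
  show "inv_into UNIV \<sigma> (to_ac a) = to_ac a" for a
    using base_autos_fix[OF assms, of a] base_autos_bij[OF assms]
    by (simp add: bij_is_inj inv_f_eq)
qed

text \<open>A polynomial \<open>m\<close> of least degree with root \<open>x\<close> divides all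
  others with that root, in particular \<open>p\<close>; being a nonunit, it is associated to the
  irreducible \<open>p\<close>.\<close>

lemma irreducible_dvd_of_root:
  fixes p :: "'a::field poly"
  assumes "irreducible p" "poly (map_poly to_ac p) x = 0" "poly (map_poly to_ac f) x = 0"
  shows "p dvd f"
proof -
  define Q where "Q = (\<lambda>d. \<exists>m. m \<noteq> 0 \<and> poly (map_poly to_ac m) x = 0 \<and> degree m = d)"
  have "p \<noteq> 0" using assms(1) by auto
  then have "Q (degree p)" using assms(2) by (auto simp: Q_def)
  then have "Q (LEAST d. Q d)" by (rule LeastI)
  then obtain m where m: "m \<noteq> 0" "poly (map_poly to_ac m) x = 0"
      and deg: "degree m = (LEAST d. Q d)"
    unfolding Q_def by blast
  have dvd: "m dvd g" if "poly (map_poly to_ac g) x = 0" for g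
  proof -
    have "poly (map_poly to_ac (g div m * m + g mod m)) x = 0" using that by simp
    then have "poly (map_poly to_ac (g mod m)) x = 0"
      unfolding to_ac.map_poly_add to_ac.map_poly_mult using m(2) by simp
    then have "g mod m \<noteq> 0 \<Longrightarrow> degree m \<le> degree (g mod m)"
      unfolding deg by (intro Least_le) (auto simp: Q_def)
    then have "g mod m = 0" using degree_mod_less[OF m(1), of g] by linarith
    then show ?thesis by (simp add: dvd_eq_mod_eq_0)
  qed
  from dvd[OF assms(2)] obtain q where q: "p = m * q" by (rule dvdE)
  have "\<not> is_unit m"
    using m by (auto simp: is_unit_poly_iff map_poly_pCons)
  then have "is_unit q" using assms(1) q by (metis irreducibleD)
  then have "p dvd m" using q by simp
  then show ?thesis using dvd[OF assms(3)] dvd_trans by blast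
qed

text \<open>Every polynomial over the base field with root \<open>x\<close> is a multiple of
  \<open>p\<close> and so vanishes at \<open>y\<close>. Hence sending \<open>x\<close> to
  \<open>y\<close> extends the identity to a partial homomorphism, and then to the whole
  closure.\<close>

theorem conjugate_by_base_auto:
  fixes p :: "'a::field poly"
  assumes "irreducible p" "poly (map_poly to_ac p) x = 0" "poly (map_poly to_ac p) y = 0"
  obtains \<sigma> where "\<sigma> \<in> base_autos" "\<sigma> x = y"
proof -
  define M0 :: "('a alg_closure \<times> 'a alg_closure) set" where "M0 = range (\<lambda>a. (to_ac a, to_ac a))"
  have M0: "partial_hom to_ac M0"
    unfolding partial_hom_def M0_def by (auto simp flip: to_ac_add to_ac_mult)
  have "poly g y = 0" if rel: "related_polys M0 f g" and f: "poly f x = 0" for f g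
  proof -
    have "\<exists>a. coeff f i = to_ac a \<and> coeff g i = to_ac a" for i
      using rel by (auto simp: related_polys_def M0_def)
    then obtain c where c: "\<And>i. coeff f i = to_ac (c i)" "\<And>i. coeff g i = to_ac (c i)"
      by metis
    then have "f = g" by (intro poly_eqI) simp
    define q where "q = map_poly of_ac f"
    have "map_poly to_ac q = f"
      unfolding q_def by (intro poly_eqI) (simp add: coeff_map_poly c)
    with f have "p dvd q" using irreducible_dvd_of_root[OF assms(1,2)] by blast
    then obtain r where "q = p * r" by (rule dvdE)
    then have "f = map_poly to_ac p * map_poly to_ac r"
      using \<open>map_poly to_ac q = f\<close> to_ac.map_poly_mult by metis
    then show ?thesis using assms(3) \<open>f = g\<close> by simp
  qed
  then obtain M' where M': "partial_hom to_ac M'" "(x, y) \<in> M'"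
    using ph_adjoin[OF ring_map_to_ac M0] by metis
  obtain \<sigma> where \<sigma>: "ring_map \<sigma>" "\<forall>(x, y)\<in>M'. \<sigma> x = y"
    by (rule partial_hom_extend[OF ring_map_to_ac M'(1)])
  have "\<sigma> \<in> base_autos"
    using \<sigma> ph_base[OF ring_map_to_ac M'(1)] by (intro base_autosI) fast+
  moreover have "\<sigma> x = y" using \<sigma>(2) M'(2) by fast
  ultimately show thesis by (rule that)
qed

section \<open>Irreducible polynomials over the rational function field\<close>

lemma ring_map_to_fract: "ring_map to_fract"
  by (simp add: ring_map_def)

interpretation to_fract: ring_map to_fract
  by (rule ring_map_to_fract)

text \<open>The scalar \<open>c\<close> comes from clearing denominators. If the prime
  \<open>s\<close> divides \<open>c\<close>, it divides \<open>g\<close> or \<open>h\<close> and is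
  cancelled; \<open>N\<close> bounds how often this happens. Once \<open>s\<close> does not divide
  \<open>c\<close>, the usual Eisenstein argument applies.\<close>

lemma eisenstein_factor:
  fixes P g h :: "'a::idom poly"
  assumes s: "prime_elem s" and P: "P = monom 1 m + smult s Q" and deg: "degree Q < m"
    and Q0: "\<not> s dvd coeff Q 0"
    and "\<not> s ^ N dvd c" "smult c P = g * h"
  shows "degree g = 0 \<or> degree h = 0"
  using assms(5,6)
proof (induction N arbitrary: c g h)
  case 0
  then show ?case by simp
next
  case (Suc N)
  have s0: "s \<noteq> 0" using s by auto
  have coeff_P: "coeff (smult c P) i = (if i = m then c else c * s * coeff Q i)" for i
    using deg by (auto simp: P coeff_eq_0 mult.assoc)
  have prime: "prime_elem [:s:]" using s by (rule lift_prime_elem_poly)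
  show ?case
  proof (cases "s dvd c")
    case True
    then obtain c' where c': "c = s * c'" by (rule dvdE)
    have c'N: "\<not> s ^ N dvd c'" using Suc.prems(1) s0 by (simp add: c')
    have gh: "[:s:] * smult c' P = g * h" using Suc.prems(2) by (simp add: c' mult.commute)
    then have "[:s:] dvd g * h" by (metis dvd_triv_left)
    then consider "[:s:] dvd g" | "[:s:] dvd h" using prime prime_elem_dvd_mult_iff by blast
    then show ?thesis
    proof cases
      case 1
      then obtain g' where g': "g = [:s:] * g'" by (rule dvdE)
      have "[:s:] * smult c' P = [:s:] * (g' * h)" using gh unfolding g' by (simp only: mult.assoc)
      then have "smult c' P = g' * h" using s0 by (subst (asm) mult_cancel_left) simp
      then show ?thesis using Suc.IH[OF c'N] s0 by (simp add: g')
    next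
      case 2
      then obtain h' where h': "h = [:s:] * h'" by (rule dvdE)
      have "[:s:] * smult c' P = [:s:] * (g * h')" using gh unfolding h' by (simp only: mult.left_commute)
      then have "smult c' P = g * h'" using s0 by (subst (asm) mult_cancel_left) simp
      then show ?thesis using Suc.IH[OF c'N] s0 by (simp add: h')
    qed
  next
    case False
    have "\<not> [:s:] dvd g * h"
      using False coeff_P[of m] by (metis Suc.prems(2) const_poly_dvd_iff)
    then have "\<exists>i. \<not> s dvd coeff g i" "\<exists>i. \<not> s dvd coeff h i"
      by (metis const_poly_dvd_iff dvd_mult2 dvd_mult)+
    \<comment> \<open>The first coefficients of \<open>g\<close> and \<open>h\<close> that
      \<open>s\<close> does not divide produce a coefficient of \<open>smult c P\<close> that
      \<open>s\<close> does not divide. Only the leading one qualifies, so \<open>i\<close> and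
      \<open>j\<close> are the full degrees.\<close>
    then obtain i j where i: "\<not> s dvd coeff g i" "\<forall>k<i. s dvd coeff g k"
      and j: "\<not> s dvd coeff h j" "\<forall>k<j. s dvd coeff h k"
      unfolding exists_least_iff[of "\<lambda>i. \<not> s dvd coeff g i"]
        exists_least_iff[of "\<lambda>i. \<not> s dvd coeff h i"] by blast
    let ?F = "\<lambda>k. coeff g k * coeff h (i + j - k)"
    have "sum ?F {..i+j} = ?F i + sum ?F ({..i+j} - {i})"
      by (rule sum.remove) auto
    then have co: "coeff (g * h) (i + j) = coeff g i * coeff h j + sum ?F ({..i+j} - {i})"
      by (simp add: coeff_mult)
    have dv: "s dvd sum ?F ({..i+j} - {i})"
    proof (rule dvd_sum)
      fix k assume k: "k \<in> {..i + j} - {i}"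
      show "s dvd coeff g k * coeff h (i + j - k)"
        using i(2) j(2) k by (cases "k < i") auto
    qed
    have "\<not> s dvd coeff g i * coeff h j"
      using i(1) j(1) s prime_elem_dvd_mult_iff by blast
    then have "\<not> s dvd coeff (g * h) (i + j)"
      unfolding co dvd_add_left_iff[OF dv] .
    then have ij: "i + j = m"
      unfolding Suc.prems(2)[symmetric] coeff_P by (auto split: if_splits)
    have "degree (smult c P) \<le> m"
      using deg coeff_P by (intro degree_le) (auto simp: coeff_eq_0)
    moreover have "g \<noteq> 0" "h \<noteq> 0" using i j by auto
    ultimately have "degree g + degree h \<le> m"
      using Suc.prems(2) by (simp add: degree_mult_eq)
    moreover have "i \<le> degree g" "j \<le> degree h"
      using i(1) j(1) by (metis coeff_eq_0 dvd_0_right not_le)+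
    ultimately have degs: "degree g = i" "degree h = j" using ij by auto
    have "i = 0 \<or> j = 0"
    proof (rule ccontr)
      assume "\<not> ?thesis"
      then have "s * s dvd coeff g 0 * coeff h 0" using i(2) j(2) by (intro mult_dvd_mono) auto
      also have "coeff g 0 * coeff h 0 = coeff (smult c P) 0"
        using Suc.prems(2) by (simp add: coeff_mult)
      also have "\<dots> = s * (c * coeff Q 0)" using deg coeff_P[of 0] by simp
      finally have "s dvd c * coeff Q 0" using s0 by simp
      then show False using False Q0 s prime_elem_dvd_mult_iff by blast
    qed
    then show ?thesis using degs by auto
  qed
qed

lemma clear_denominators:
  fixes p :: "'a::idom fract poly"
  obtains c g where "c \<noteq> 0" "smult (to_fract c) p = map_poly to_fract g"
proof -
  have "\<exists>c g. c \<noteq> 0 \<and> smult (to_fract c) p = map_poly to_fract g"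
  proof (induction p)
    case 0
    then show ?case by (intro exI[of _ 1] exI[of _ 0]) simp
  next
    case (pCons a p)
    then obtain c g where cg: "c \<noteq> 0" "smult (to_fract c) p = map_poly to_fract g" by blast
    obtain x y where xy: "a = Fract x y" "y \<noteq> 0" by (cases a) auto
    have "to_fract (y * c) * a = to_fract (c * x)"
      using xy by (simp add: to_fract_def eq_fract)
    moreover have "smult (to_fract (y * c)) p = map_poly to_fract (smult y g)"
      using cg(2) by (metis fract_poly_smult smult_smult to_fract_mult)
    ultimately have "smult (to_fract (y * c)) (pCons a p) = map_poly to_fract (pCons (c * x) (smult y g))"
      by (simp add: map_poly_pCons)
    then show ?case using cg(1) xy(2) by (intro exI[of _ "y * c"]) auto
  qed
  then show thesis using that by blast
qed

text \<open>A factorisation over the fraction field becomes one of a multiple of the polynomial by a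
  nonzero \<open>c * d\<close>; \<open>fin\<close> bounds the power of \<open>s\<close> in that
  multiple and so takes the place of unique factorisation.\<close>

lemma eisenstein_irreducible:
  fixes Q :: "'a::idom poly"
  assumes s: "prime_elem s" and deg: "degree Q < m" and Q0: "\<not> s dvd coeff Q 0"
    and fin: "\<And>c. c \<noteq> 0 \<Longrightarrow> \<exists>N. \<not> s ^ N dvd c"
  shows "irreducible (map_poly to_fract (monom 1 m + smult s Q))"
proof -
  define P where "P = monom 1 m + smult s Q"
  have "coeff P m = 1" using deg by (simp add: P_def coeff_eq_0)
  then have P0: "P \<noteq> 0" "0 < degree P" using deg le_degree[of P m] by auto
  have unit: "is_unit a" if "a \<noteq> 0" "degree a = 0" for a :: "'a fract poly"
    using that by (metis is_unit_iff_degree)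
  show ?thesis
    unfolding P_def[symmetric]
  proof (rule irreducibleI)
    show "map_poly to_fract P \<noteq> 0" using P0 by simp
    show "\<not> is_unit (map_poly to_fract P)"
      using P0 is_unit_iff_degree[of "map_poly to_fract P"] by (simp add: degree_map_poly)
    fix a b assume ab: "map_poly to_fract P = a * b"
    have ab0: "a \<noteq> 0" "b \<noteq> 0" using ab P0 by auto
    obtain c g where cg: "c \<noteq> 0" "smult (to_fract c) a = map_poly to_fract g"
      by (rule clear_denominators)
    obtain d h where dh: "d \<noteq> 0" "smult (to_fract d) b = map_poly to_fract h"
      by (rule clear_denominators)
    have "map_poly to_fract (smult (c * d) P) = map_poly to_fract (g * h)"
      by (simp add: ab cg(2)[symmetric] dh(2)[symmetric] mult.commute)
    then have "smult (c * d) P = g * h" by (simp only: fract_poly_eq_iff)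
    moreover obtain N where "\<not> s ^ N dvd c * d" using fin cg(1) dh(1) by (metis no_zero_divisors)
    ultimately have "degree g = 0 \<or> degree h = 0"
      by (intro eisenstein_factor[OF s P_def deg Q0])
    moreover have "degree a = degree g"
      using arg_cong[OF cg(2), of degree] cg(1) by (simp add: degree_map_poly)
    moreover have "degree b = degree h"
      using arg_cong[OF dh(2), of degree] dh(1) by (simp add: degree_map_poly)
    ultimately show "is_unit a \<or> is_unit b" using unit ab0 by auto
  qed
qed

section \<open>Irreducibility of the shifted iterates of \<open>L\<close> and of the
  quadratic\<close>

primrec iter_L :: "'a::comm_ring_1 \<Rightarrow> nat \<Rightarrow> 'a poly" where
  "iter_L s 0 = [:0, 1:]"
| "iter_L s (Suc j) = (iter_L s j)\<^sup>2 + smult s (iter_L s j)"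

text \<open>Modulo \<open>s\<close> the map \<open>L\<close> is squaring, which leaves only the
  leading monomial.\<close>

lemma iter_L_shape:
  fixes s :: "'a::idom"
  obtains Q where "iter_L s j = monom 1 (2 ^ j) + smult s Q" "degree Q < 2 ^ j" "coeff Q 0 = 0"
proof -
  have "\<exists>Q. iter_L s j = monom 1 (2 ^ j) + smult s Q \<and> degree Q < 2 ^ j \<and> coeff Q 0 = 0"
  proof (induction j)
    case 0
    then show ?case by (intro exI[of _ 0]) (simp add: monom_altdef)
  next
    case (Suc j)
    define m where "m = (2::nat) ^ j"
    from Suc obtain Q where Q: "iter_L s j = monom 1 m + smult s Q" "degree Q < m" "coeff Q 0 = 0"
      by (auto simp: m_def)
    \<comment> \<open>\<open>R\<close> is what remains of the square plus \<open>s\<close> times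
      \<open>iter_L s j\<close> after the leading monomial is removed and one factor
      \<open>s\<close> is taken out. The doubled term stays, as the characteristic is arbitrary
      here.\<close>
    define R where "R = monom 1 m * Q + monom 1 m * Q + smult s (Q * Q) + monom 1 m + smult s Q"
    have 1: "iter_L s (Suc j) = monom 1 (2 * m) + smult s R"
    proof -
      define S where "S = [:s:]"
      have S: "smult s p = S * p" for p by (simp add: S_def)
      have "monom 1 (2 * m) = monom 1 m * (monom 1 m :: 'a poly)"
        by (simp add: mult_monom mult_2)
      then show ?thesis
        by (simp only: iter_L.simps Q(1) R_def S power2_eq_square distrib_left distrib_right
            ac_simps)
    qed
    have "degree R \<le> m + degree Q"
      unfolding R_def using Q(2)
      by (intro degree_add_le order.trans[OF degree_mult_le] order.trans[OF degree_smult_le])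
        (auto simp: degree_monom_eq)
    then have 2: "degree R < 2 * m" using Q(2) by simp
    have "m > 0" by (simp add: m_def)
    then have 3: "coeff R 0 = 0" by (simp add: R_def Q(3) coeff_mult)
    show ?case using 1 2 3 by (auto simp: m_def)
  qed
  then show thesis using that by blast
qed

lemma (in ring_map) poly_map_iter_L:
  "poly (map_poly h (iter_L s j)) x = ((\<lambda>x. x\<^sup>2 + h s * x) ^^ j) x"
  by (induction j)
    (simp_all add: map_poly_pCons power2_eq_square map_poly_add map_poly_mult map_poly_smult)

lemma prime_elem_s: "prime_elem [:[:0, 1:] :: 'k::field poly:]"
  by (intro lift_prime_elem_poly prime_elem_linear_field_poly) simp

text \<open>The leading coefficient of \<open>c\<close> in \<open>t\<close> is a nonzero polynomial
  in \<open>s\<close>, whose degree bounds the exponent.\<close>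

lemma finite_multiplicity_s:
  fixes c :: "'k::field poly poly"
  assumes "c \<noteq> 0"
  shows "\<exists>N. \<not> [:[:0, 1:]:] ^ N dvd c"
proof (rule ccontr)
  assume *: "\<nexists>N. \<not> [:[:0, 1:]:] ^ N dvd c"
  define N where "N = Suc (degree (lead_coeff c))"
  have "[:[:0, 1:]:] ^ N = [:[:0, 1:] ^ N :: 'k poly:]" by (induction N) (auto simp: one_pCons)
  with * have "[:[:0, 1:] ^ N:] dvd c" by metis
  then have "[:0, 1:] ^ N dvd lead_coeff c" by (simp add: const_poly_dvd_iff)
  then have "degree ([:0, 1:] ^ N :: 'k poly) \<le> degree (lead_coeff c)"
    using assms by (intro dvd_imp_degree_le) auto
  then show False by (simp add: degree_power_eq N_def)
qed

lemma to_fract_s: "to_fract [:[:0, 1:]:] = var_s" and to_fract_t: "to_fract [:0, 1:] = var_t"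
  by (simp_all add: to_fract_def var_s_def var_t_def)

text \<open>Adding \<open>s\<close> raises the constant coefficient of \<open>Q\<close> from 0 to 1,
  which is what Eisenstein at \<open>s\<close> asks for.\<close>

lemma irreducible_iter_L:
  "irreducible (map_poly to_fract (iter_L [:[:0, 1:]:] j + [:[:[:0, 1:] :: 'k::field poly:]:]))"
proof -
  let ?s = "[:[:0, 1:]:] :: 'k poly poly"
  obtain Q where Q: "iter_L ?s j = monom 1 (2 ^ j) + smult ?s Q" "degree Q < 2 ^ j" "coeff Q 0 = 0"
    by (rule iter_L_shape)
  have "\<not> ?s dvd 1" using prime_elem_s by (rule prime_elem_not_unit)
  then have "irreducible (map_poly to_fract (monom 1 (2 ^ j) + smult ?s (Q + 1)))"
    using Q by (intro eisenstein_irreducible prime_elem_s finite_multiplicity_s degree_add_less) auto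
  moreover have "iter_L ?s j + [:?s:] = monom 1 (2 ^ j) + smult ?s (Q + 1)"
    by (simp add: Q(1) smult_add_right one_pCons)
  ultimately show ?thesis by metis
qed

text \<open>For \<open>x = a / b\<close>, compare degrees in \<open>t\<close> in
  \<open>t*b*b = -(s*a*b + a*a)\<close>. The left side has odd degree
  \<open>2 * degree b + 1\<close>; the right side has degree at most \<open>2 * degree b\<close> if
  \<open>degree a \<le> degree b\<close>, and the even degree \<open>2 * degree a\<close>
  otherwise.\<close>

lemma frakG_no_root: "poly frakG (x :: 'k::field rfun2) \<noteq> 0"
proof
  assume root: "poly frakG x = 0"
  let ?s = "[:[:0, 1:]:] :: 'k poly poly" and ?t = "[:0, 1:] :: 'k poly poly"
  obtain a b where x: "x = Fract a b" "b \<noteq> 0" by (cases x) auto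
  have tb: "to_fract b \<noteq> 0" using x by simp
  have xb: "x * to_fract b = to_fract a" using x by (simp add: to_fract_def eq_fract)
  have "var_t + x * var_s + x * x = 0" using root by (simp add: frakG_def algebra_simps)
  then have "(var_t + x * var_s + x * x) * (to_fract b * to_fract b) = 0" by simp
  then have "var_t * to_fract b * to_fract b + var_s * (x * to_fract b) * to_fract b
      + (x * to_fract b) * (x * to_fract b) = 0"
    by (simp add: algebra_simps)
  then have "to_fract (?t * b * b + ?s * a * b + a * a) = 0"
    unfolding xb to_fract_s[symmetric] to_fract_t[symmetric]
    by (simp only: to_fract_add to_fract_mult)
  then have eq: "?t * b * b = - (?s * a * b + a * a)"
    by (simp only: to_fract_eq_0_iff add.assoc add_eq_0_iff2)
  have "degree (?t * b * b) = 2 * degree b + 1"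
    using x(2) by (simp add: degree_mult_eq)
  then have degt: "degree (?s * a * b + a * a) = 2 * degree b + 1"
    unfolding eq by (simp only: degree_minus)
  have "?s * a * b = smult [:0, 1:] (a * b)" by simp
  then have degs: "degree (?s * a * b) \<le> degree a + degree b"
    by (metis degree_mult_le degree_smult_le order.trans)
  show False
  proof (cases "degree a \<le> degree b")
    case True
    have "degree (?s * a * b + a * a) \<le> 2 * degree b"
      using True degs degree_mult_le[of a a] by (intro degree_add_le) auto
    then show False using degt by linarith
  next
    case False
    then have "degree (?s * a * b) < degree (a * a)"
      using degs by (cases "a = 0") (auto simp: degree_mult_eq)
    then have "degree (?s * a * b + a * a) = degree (a * a)"
      by (rule degree_add_eq_right)
    also have "\<dots> = 2 * degree a" using False by (cases "a = 0") (auto simp: degree_mult_eq)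
    finally show False using degt by presburger
  qed
qed

lemma frakG_irreducible: "irreducible (frakG :: 'k::field rfun2 poly)"
proof (rule irreducibleI)
  show "frakG \<noteq> (0 :: 'k rfun2 poly)" by (simp add: frakG_def)
  show "\<not> is_unit (frakG :: 'k rfun2 poly)"
    using is_unit_iff_degree[of "frakG :: 'k rfun2 poly"] by (simp add: frakG_def)
  fix a b :: "'k rfun2 poly" assume ab: "frakG = a * b"
  have ab0: "a \<noteq> 0" "b \<noteq> 0" using ab by (auto simp: frakG_def)
  have sum: "degree a + degree b = 2"
    using arg_cong[OF ab, of degree] ab0 by (simp add: degree_mult_eq frakG_def)
  have nd: "degree p \<noteq> 1" if "p dvd frakG" for p :: "'k rfun2 poly"
  proof
    assume "degree p = 1"
    then obtain c d where p: "p = [:c, d:]" "d \<noteq> 0" using degree1_coeffs by metis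
    then have "poly p (- c / d) = 0" by simp
    then show False using that frakG_no_root by (metis dvdE mult_zero_left poly_mult)
  qed
  have "degree a \<noteq> 1" "degree b \<noteq> 1" using nd[of a] nd[of b] unfolding ab by simp_all
  with sum have "degree a = 0 \<or> degree b = 0" by presburger
  then show "is_unit a \<or> is_unit b" using ab0 is_unit_iff_degree by metis
qed

section \<open>Substitutions in the rational function field\<close>

lemma ring_map_fract_extend:
  fixes f :: "'a::idom \<Rightarrow> 'b::field"
  assumes "ring_map f" "\<And>x. f x = 0 \<Longrightarrow> x = 0"
  obtains F where "ring_map F" "\<And>x. F (to_fract x) = f x"
proof -
  interpret ring_map f by fact
  have "\<exists>a b. x = Fract a b \<and> b \<noteq> 0" for x :: "'a fract" by (cases x) auto
  then obtain num den where nd: "\<And>x :: 'a fract. x = Fract (num x) (den x)" "\<And>x. den x \<noteq> 0"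
    by metis
  define F where "F = (\<lambda>x. f (num x) / f (den x))"
  have F: "F (Fract a b) = f a / f b" if "b \<noteq> 0" for a b
  proof -
    let ?x = "Fract a b"
    have "a * den ?x = num ?x * b"
      using nd(1)[of ?x] nd(2)[of ?x] that by (metis eq_fract(1))
    then have "f a * f (den ?x) = f (num ?x) * f b" by (metis map_mult)
    moreover have "f b \<noteq> 0" "f (den ?x) \<noteq> 0" using assms(2) that nd(2) by blast+
    ultimately show ?thesis by (simp add: F_def field_simps)
  qed
  show thesis
  proof
    show "F (to_fract x) = f x" for x by (simp add: to_fract_def F)
    show "ring_map F"
    proof
      show "F 1 = 1" using F[of 1 1] by (simp add: One_fract_def)
      fix x y :: "'a fract"
      obtain a b c d where x: "x = Fract a b" "b \<noteq> 0" and y: "y = Fract c d" "d \<noteq> 0"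
        using nd by metis
      have "f b \<noteq> 0" "f d \<noteq> 0" using assms(2) x y by blast+
      then show "F (x + y) = F x + F y" "F (x * y) = F x * F y"
        using x y by (simp_all add: F field_simps)
    qed
  qed
qed

text \<open>Composition with a nonconstant polynomial is injective, so it passes to
  fractions.\<close>

lemma rfun2_substitute_t:
  fixes q :: "'k::field poly poly"
  assumes "0 < degree q"
  obtains \<psi> :: "'k rfun2 \<Rightarrow> 'k rfun2" where "ring_map \<psi>" "\<And>p. \<psi> (to_fract p) = to_fract (pcompose p q)"
proof -
  define f where "f = (\<lambda>p. to_fract (pcompose p q))"
  have "pcompose 1 q = 1" by (metis one_pCons pcompose_const)
  then have f: "ring_map f" by (simp add: ring_map_def f_def pcompose_add pcompose_mult)
  have "p = 0" if "f p = 0" for p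
    using that assms by (simp add: f_def) (metis pcompose_eq_0)
  then show thesis
    using ring_map_fract_extend[OF f] that unfolding f_def by metis
qed

section \<open>The kernels of the iterates of L\<close>

locale quadratic_module =
  fixes s t :: "'a::alg_closed_field"
  assumes two_zero [simp]: "(2::'a) = 0" and s_nonzero: "s \<noteq> 0"
begin

definition L :: "'a \<Rightarrow> 'a" where "L x = x\<^sup>2 + s * x"
definition G :: "'a \<Rightarrow> 'a" where "G x = L x + t"
definition W :: "nat \<Rightarrow> 'a set" where "W j = {x. (L ^^ j) x = 0}"

text \<open>The \<open>W j\<close> form a chain and are all the finite submodules, so for a torsion element \<open>e\<close> this is the
  submodule generated by \<open>e\<close>.\<close>
definition cyc :: "'a \<Rightarrow> 'a set" where "cyc e = {x. \<forall>j. e \<in> W j \<longrightarrow> x \<in> W j}"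

lemma add_self [simp]: "x + x = (0::'a)"
  by (metis mult_2 mult_zero_left two_zero)

lemma add_self_left [simp]: "x + (x + y) = (y::'a)"
  by (simp flip: add.assoc)

lemma add_eq_0 [simp]: "x + y = 0 \<longleftrightarrow> x = (y::'a)"
  by (metis add_self add_left_cancel)

lemma L_add: "L (x + y) = L x + L y"
proof -
  have "(x + y)\<^sup>2 = x\<^sup>2 + y\<^sup>2 + (x * y + x * y)" 
    by (simp only: power2_eq_square distrib_left distrib_right ac_simps)
  then show ?thesis by (simp add: L_def algebra_simps)
qed

lemma Ln_add: "(L ^^ n) (x + y) = (L ^^ n) x + (L ^^ n) y"
  by (induction n) (simp_all add: L_add)

lemma L_0 [simp]: "L 0 = 0" by (simp add: L_def)

lemma Ln_0 [simp]: "(L ^^ n) 0 = 0"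
  by (induction n) simp_all

lemma L_eq_0: "L x = 0 \<longleftrightarrow> x = 0 \<or> x = s"
proof -
  have "L x = x * (x + s)" by (simp add: L_def power2_eq_square algebra_simps)
  then show ?thesis by simp
qed

text \<open>Consequently the roots of the iterate form a coset of \<open>W n\<close>.\<close>

lemma Gn_add: "(G ^^ n) (x + y) = (G ^^ n) x + (L ^^ n) y"
  by (induction n) (simp_all add: G_def L_add algebra_simps)

lemma quadratic_root: "\<exists>x. x\<^sup>2 + s * x + c = 0"
  using alg_closed_imp_poly_has_root[of "[:c, s, 1:]"]
  by (auto simp: power2_eq_square algebra_simps)

lemma surj_L: "surj L"
proof -
  have "\<exists>x. c = L x" for c
    using quadratic_root[of c] by (auto simp: L_def)
  then show ?thesis by (simp add: surj_def)
qed

lemma surj_G: "surj G"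
proof -
  have "\<exists>x. c = G x" for c
    using surj_L by (auto simp: G_def surj_def) (metis add_self_left add.commute)
  then show ?thesis by (simp add: surj_def)
qed

lemma Ln_surj: "\<exists>x. (L ^^ n) x = c" and Gn_surj: "\<exists>x. (G ^^ n) x = c"
  using surj_fn[OF surj_L, of n] surj_fn[OF surj_G, of n] by (metis surjD)+

lemma W_0: "W 0 = {0}"
  by (simp add: W_def)

lemma W_add: "x \<in> W j \<Longrightarrow> y \<in> W j \<Longrightarrow> x + y \<in> W j"
  by (simp add: W_def Ln_add)

lemma W_zero [simp]: "0 \<in> W j"
  by (simp add: W_def)

lemma W_L: "x \<in> W j \<Longrightarrow> L x \<in> W j"
  by (simp add: W_def flip: funpow_swap1)

lemma W_Suc_subset: "W j \<subseteq> W (Suc j)"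
  by (auto simp: W_def)

lemma W_mono: "i \<le> j \<Longrightarrow> W i \<subseteq> W j"
  by (rule lift_Suc_mono_le[of W]) (rule W_Suc_subset)

lemma W_Suc: "W (Suc j) = W j \<union> {x. (L ^^ j) x = s}"
  by (auto simp: W_def L_eq_0)

text \<open>\<open>W (Suc j)\<close> splits into \<open>W j\<close> and the fibre of
  \<open>L ^^ j\<close> over \<open>s\<close>. The fibre is a translate of \<open>W j\<close>,
  disjoint from it because \<open>s\<close> is nonzero, so the cardinality doubles.\<close>

lemma card_W: "finite (W j) \<and> card (W j) = 2 ^ j"
  and card_W_gen: "card {x. (L ^^ j) x = s} = 2 ^ j"
proof -
  have gen: "finite {x. (L ^^ j) x = s} \<and> card {x. (L ^^ j) x = s} = card (W j)" if "finite (W j)" for j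
  proof -
    obtain w where w: "(L ^^ j) w = s" using Ln_surj by blast
    have "{x. (L ^^ j) x = s} = (+) w ` W j"
    proof (intro equalityI subsetI)
      fix x assume "x \<in> {x. (L ^^ j) x = s}"
      then have "w + x \<in> W j" by (simp add: W_def Ln_add w)
      then show "x \<in> (+) w ` W j" by (metis add_self_left imageI)
    qed (auto simp: W_def Ln_add w)
    then show ?thesis using that by (simp add: card_image)
  qed
  have all: "finite (W j) \<and> card (W j) = 2 ^ j" for j
  proof (induction j)
    case 0
    then show ?case by (simp add: W_0)
  next
    case (Suc j)
    have "W j \<inter> {x. (L ^^ j) x = s} = {}" using s_nonzero by (auto simp: W_def)
    then show ?case using Suc gen[of j] by (simp add: W_Suc card_Un_disjoint)
  qed
  show "finite (W j) \<and> card (W j) = 2 ^ j" by (rule all)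
  show "card {x. (L ^^ j) x = s} = 2 ^ j" using gen all by simp
qed

text \<open>\<open>L e\<close> generates the kernel one level lower, and all elements of the top
  layer lie in the coset of \<open>e\<close> modulo that kernel. Thus \<open>e\<close> is a
  generator, and properties closed under addition and \<open>L\<close> need checking at
  \<open>e\<close> only.\<close>

lemma W_subset_submodule:
  assumes add: "\<And>x y. x \<in> S \<Longrightarrow> y \<in> S \<Longrightarrow> x + y \<in> S" and L: "\<And>x. x \<in> S \<Longrightarrow> L x \<in> S"
    and "e \<in> S" "(L ^^ j) e = s"
  shows "W (Suc j) \<subseteq> S"
  using assms(3,4)
proof (induction j arbitrary: e)
  case 0
  then have "0 \<in> S" using add[of e e] by simp
  then show ?case using 0 by (auto simp: W_Suc W_0)
next
  case (Suc j)
  have IH: "W (Suc j) \<subseteq> S"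
    using Suc.IH[of "L e"] Suc.prems L by (simp flip: funpow_swap1)
  show ?case
  proof
    fix x assume "x \<in> W (Suc (Suc j))"
    then consider "x \<in> W (Suc j)" | "(L ^^ Suc j) x = s"
      unfolding W_Suc[of "Suc j"] by blast
    then show "x \<in> S"
    proof cases
      case 1
      then show ?thesis using IH by blast
    next
      case 2
      then have "e + x \<in> W (Suc j)" using Suc.prems(2) by (simp add: W_def L_add Ln_add)
      then have "e + (e + x) \<in> S" using IH add Suc.prems(1) by blast
      then show ?thesis by simp
    qed
  qed
qed

lemma cyc_zero: "cyc 0 = {0}"
  using W_0 by (auto simp: cyc_def)

lemma cyc_gen:
  assumes "(L ^^ j) e = s"
  shows "cyc e = W (Suc j)"
proof -
  have "e \<notin> W j" using assms s_nonzero by (simp add: W_def)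
  moreover have "e \<in> W (Suc j)" using assms by (simp add: W_Suc)
  ultimately have "e \<in> W i \<longleftrightarrow> Suc j \<le> i" for i
    using W_mono[of i j] W_mono[of "Suc j" i] not_less_eq_eq[of i j] by blast
  then show ?thesis using W_mono by (auto simp: cyc_def)
qed

text \<open>Every nonzero element lies in the top layer of some \<open>W (Suc i)\<close> and
  therefore generates it.\<close>

lemma W_cases:
  assumes "e \<in> W j"
  obtains "e = 0" | i where "i < j" "(L ^^ i) e = s"
proof -
  have "e = 0 \<or> (\<exists>i<j. (L ^^ i) e = s)"
    using assms by (induction j) (auto simp: W_0 W_Suc less_Suc_eq)
  then show thesis using that by blast
qed

lemma cyc_subset: "e \<in> W j \<Longrightarrow> cyc e \<subseteq> W j"
  by (auto simp: cyc_def)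

text \<open>Each of the \<open>2 ^ m\<close> elements in the top layer of \<open>W (Suc m)\<close>
  contributes \<open>2 ^ Suc m\<close>, together \<open>2 * 4 ^ m\<close>. The factor 3 keeps the
  resulting geometric sum in the natural numbers.\<close>

lemma card_Sigma_cyc: "3 * card (Sigma (W m) cyc) = 2 * 4 ^ m + 1"
proof -
  have fin: "finite (cyc e)" if "e \<in> W m" for e m
    using cyc_subset[OF that] card_W finite_subset by blast
  have "3 * (\<Sum>e\<in>W m. card (cyc e)) = 2 * 4 ^ m + 1"
  proof (induction m)
    case 0
    then show ?case by (simp add: W_0 cyc_zero)
  next
    case (Suc m)
    have disj: "W m \<inter> {x. (L ^^ m) x = s} = {}" using s_nonzero by (auto simp: W_def)
    have "finite {x. (L ^^ m) x = s}"
      using card_W[of "Suc m"] W_Suc[of m] by simp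
    then have "(\<Sum>e\<in>W (Suc m). card (cyc e)) =
        (\<Sum>e\<in>W m. card (cyc e)) + (\<Sum>e\<in>{x. (L ^^ m) x = s}. card (cyc e))"
      unfolding W_Suc using card_W disj by (intro sum.union_disjoint) auto
    also have "(\<Sum>e\<in>{x. (L ^^ m) x = s}. card (cyc e)) = (\<Sum>e\<in>{x. (L ^^ m) x = s}. 2 ^ Suc m)"
      by (intro sum.cong) (use card_W in \<open>auto simp: cyc_gen\<close>)
    also have "\<dots> = 2 * (2 ^ m * 2 ^ m)" by (simp add: card_W_gen)
    also have "(2::nat) ^ m * 2 ^ m = 4 ^ m" by (simp flip: power_mult_distrib)
    finally show ?case using Suc.IH by simp
  qed
  then show ?thesis using card_W fin by (subst card_SigmaI) auto
qed

text \<open>For an additive map commuting with \<open>L\<close>, the cyclic module structure makes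
  \<open>\<sigma> + 1\<close> the multiplication by a scalar, whose image is generated by the image of a generator.\<close>

lemma image_plus_id:
  assumes add: "\<And>x y. \<sigma> (x + y) = \<sigma> x + \<sigma> y" and comm: "\<And>x. \<sigma> (L x) = L (\<sigma> x)"
    and w: "(L ^^ m) w = s" and e: "\<sigma> w + w \<in> W (Suc m)"
  shows "(\<lambda>x. \<sigma> x + x) ` W (Suc m) = cyc (\<sigma> w + w)"
proof
  let ?f = "\<lambda>x. \<sigma> x + x"
  have f_add: "?f x + ?f y = ?f (x + y)" for x y by (simp add: add algebra_simps)
  have f_L: "L (?f x) = ?f (L x)" for x by (simp add: comm L_add)
  have w_in: "w \<in> W (Suc m)" using w by (simp add: W_Suc)
  have cyc_closed: "x + y \<in> cyc a" "L x \<in> cyc a" if "x \<in> cyc a" "y \<in> cyc a" for x y a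
    using that W_add W_L by (auto simp: cyc_def)
  have "W (Suc m) \<subseteq> {x. ?f x \<in> cyc (?f w)}"
  proof (rule W_subset_submodule[OF _ _ _ w])
    show "x + y \<in> {x. ?f x \<in> cyc (?f w)}"
      if "x \<in> {x. ?f x \<in> cyc (?f w)}" "y \<in> {x. ?f x \<in> cyc (?f w)}" for x y
      using cyc_closed(1)[of "?f x" _ "?f y"] that by (simp add: f_add)
    show "L x \<in> {x. ?f x \<in> cyc (?f w)}" if "x \<in> {x. ?f x \<in> cyc (?f w)}" for x
      using cyc_closed(2)[of "?f x"] that by (simp add: f_L)
    show "w \<in> {x. ?f x \<in> cyc (?f w)}" by (simp add: cyc_def)
  qed
  then show "?f ` W (Suc m) \<subseteq> cyc (?f w)" by blast
  \<comment> \<open>If \<open>?f w\<close> is nonzero, it generates some \<open>W (Suc i)\<close>,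
    which the image then contains, being a submodule itself.\<close>
  from e show "cyc (?f w) \<subseteq> ?f ` W (Suc m)"
  proof (cases rule: W_cases)
    case 1
    have "\<sigma> 0 = 0" using add[of 0 0] by simp
    then have "0 \<in> ?f ` W (Suc m)" by (intro image_eqI[of _ _ 0]) auto
    then show ?thesis by (simp add: 1 cyc_zero)
  next
    case (2 i)
    show ?thesis
      unfolding cyc_gen[OF 2(2)]
    proof (rule W_subset_submodule[OF _ _ _ 2(2)])
      show "?f w \<in> ?f ` W (Suc m)" using w_in by blast
      show "x + y \<in> ?f ` W (Suc m)" if "x \<in> ?f ` W (Suc m)" "y \<in> ?f ` W (Suc m)" for x y
      proof -
        from that obtain a b where "a \<in> W (Suc m)" "x = ?f a" "b \<in> W (Suc m)" "y = ?f b" by blast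
        then show ?thesis using W_add by (intro image_eqI[of _ _ "a + b"]) (simp_all only: f_add)
      qed
      show "L x \<in> ?f ` W (Suc m)" if "x \<in> ?f ` W (Suc m)" for x
      proof -
        from that obtain a where "a \<in> W (Suc m)" "x = ?f a" by blast
        then show ?thesis using W_L by (intro image_eqI[of _ _ "L a"]) (simp_all only: f_L)
      qed
    qed
  qed
qed

end

section \<open>The Galois group\<close>

lemma two_zero_rfun2_closure:
  assumes "CHAR('k::field) = 2"
  shows "(2 :: 'k rfun2 alg_closure) = 0"
proof -
  have "(2::'k) = 0" using of_nat_CHAR[where 'a='k] assms by simp
  then have "(1::'k) + 1 = 0" by simp
  then have "(1 :: 'k poly poly) + 1 = 0" by (simp add: one_pCons)
  then have "to_ac (to_fract ((1 :: 'k poly poly) + 1)) = 0" by (simp only: to_fract_0 to_ac_0)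
  then have "(1 :: 'k rfun2 alg_closure) + 1 = 0"
    by (simp only: to_fract_add to_fract_1 to_ac_add to_ac_1)
  then show ?thesis by simp
qed

lemma var_s_nonzero: "(var_s :: 'k::field rfun2) \<noteq> 0"
  by (simp flip: to_fract_s)

context
  assumes char_two: "CHAR('k::field) = 2"
begin

interpretation quadratic_module "to_ac var_s :: 'k rfun2 alg_closure" "to_ac var_t"
  by unfold_locales (simp_all add: two_zero_rfun2_closure[OF char_two] var_s_nonzero)

abbreviation (input) ac_s :: "'k rfun2 alg_closure" where "ac_s \<equiv> to_ac var_s"

section \<open>The action of the automorphisms on kernels and roots\<close>

lemma ring_map_Ln:
  fixes \<sigma> :: "'k rfun2 alg_closure \<Rightarrow> 'k rfun2 alg_closure"
  assumes "ring_map \<sigma>" "\<sigma> ac_s = ac_s"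
  shows "\<sigma> ((L ^^ j) x) = (L ^^ j) (\<sigma> x)"
proof -
  interpret sig: ring_map \<sigma> by fact
  show ?thesis by (induction j) (simp_all add: L_def assms(2))
qed

lemma base_autos_Ln: "\<sigma> \<in> base_autos \<Longrightarrow> \<sigma> ((L ^^ j) x) = (L ^^ j) (\<sigma> x)"
  by (intro ring_map_Ln base_autos_ring_map base_autos_fix)

lemma base_autos_L: "\<sigma> \<in> base_autos \<Longrightarrow> \<sigma> (L x) = L (\<sigma> x)"
  using base_autos_Ln[of \<sigma> 1] by simp

lemma base_autos_add: "\<sigma> \<in> base_autos \<Longrightarrow> \<sigma> (x + y) = \<sigma> x + \<sigma> y"
  by (simp add: base_autos_def)

lemma base_autos_Gn: "\<sigma> \<in> base_autos \<Longrightarrow> \<sigma> ((G ^^ j) x) = (G ^^ j) (\<sigma> x)"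
  by (induction j) (simp_all add: G_def base_autos_L base_autos_add base_autos_fix)

lemma base_autos_zero: "\<sigma> \<in> base_autos \<Longrightarrow> \<sigma> 0 = 0"
  using base_autos_fix[of \<sigma> 0] by simp

lemma base_autos_W: "\<sigma> \<in> base_autos \<Longrightarrow> x \<in> W j \<Longrightarrow> \<sigma> x \<in> W j"
  by (simp add: W_def base_autos_zero flip: base_autos_Ln)

lemma poly_frakG: "poly (map_poly to_ac frakG) x = G x"
  by (simp add: frakG_def map_poly_pCons G_def L_def power2_eq_square algebra_simps)

lemma iter_roots_eq: "iter_roots n = {r. (G ^^ n) r = 0}"
proof -
  have "poly (map_poly to_ac (frakG_iter n)) x = (G ^^ n) x" for x :: "'k rfun2 alg_closure"
  proof (induction n)
    case 0
    then show ?case by (simp add: frakG_iter_def map_poly_pCons)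
  next
    case (Suc n)
    have "frakG_iter (Suc n) = pcompose frakG (frakG_iter n :: 'k rfun2 poly)"
      by (simp add: frakG_iter_def)
    then show ?case
      by (simp add: to_ac.poly_map_poly_pcompose Suc poly_frakG)
  qed
  then show ?thesis by (simp add: iter_roots_def)
qed

text \<open>In characteristic 2 the hypotheses say that \<open>w\<close> and \<open>w'\<close> are
  roots of the \<open>j\<close>-th iterate of \<open>L\<close> plus \<open>s\<close>, which is
  irreducible.\<close>

lemma move_generator:
  assumes "(L ^^ j) w = ac_s" "(L ^^ j) w' = ac_s"
  obtains \<sigma> where "\<sigma> \<in> base_autos" "\<sigma> w = w'"
proof -
  let ?s = "[:[:0, 1:]:] :: 'k poly poly"
  interpret h: ring_map "to_ac \<circ> (to_fract :: 'k poly poly \<Rightarrow> _)"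
    by (intro ring_map_comp ring_map_to_ac ring_map_to_fract)
  have "poly (map_poly to_ac (map_poly to_fract (iter_L ?s j + [:?s:]))) x = (L ^^ j) x + ac_s" for x
  proof -
    have "map_poly to_ac (map_poly to_fract (iter_L ?s j + [:?s:]))
        = map_poly (to_ac \<circ> to_fract) (iter_L ?s j) + map_poly (to_ac \<circ> to_fract) [:?s:]"
      by (simp only: map_poly_map_poly to_fract_0 to_ac_0 h.map_poly_add)
    moreover have "L = (\<lambda>x. x\<^sup>2 + ac_s * x)" by (simp add: L_def fun_eq_iff)
    ultimately show ?thesis
      by (simp only: poly_add h.poly_map_iter_L) (simp add: map_poly_pCons to_fract_s)
  qed
  then show thesis
    using conjugate_by_base_auto[OF irreducible_iter_L[of j]] assms that add_self by metis
qed

text \<open>Substituting \<open>L t\<close> for \<open>t\<close> identifies \<open>k(s,v)\<close>, for a root \<open>v\<close> of \<open>G\<close>, with \<open>k(s,t)\<close>;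
  conjugating by an extension of this substitution transfers transitivity over \<open>k(s,t)\<close> to
  transitivity over \<open>k(s,v)\<close>.\<close>

lemma move_generator_fixing_root:
  assumes v: "G v = 0" and w: "(L ^^ j) w = ac_s" "(L ^^ j) w' = ac_s"
  obtains \<sigma> where "\<sigma> \<in> base_autos" "\<sigma> v = v" "\<sigma> w = w'"
proof -
  \<comment> \<open>This is \<open>L t\<close> as a polynomial in \<open>t\<close>; the inner
    \<open>[:0, 1:]\<close> is \<open>s\<close>.\<close>
  define q :: "'k poly poly" where "q = [:0, [:0, 1:], 1:]"
  have "0 < degree q" by (simp add: q_def)
  then obtain \<psi> :: "'k rfun2 \<Rightarrow> 'k rfun2"
    where psi: "ring_map \<psi>" and psi_pc: "\<And>p. \<psi> (to_fract p) = to_fract (pcompose p q)"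
    using rfun2_substitute_t by metis
  have "ring_map (to_ac \<circ> \<psi>)" using ring_map_comp[OF ring_map_to_ac psi] .
  then obtain \<Psi> where Psi: "ring_map \<Psi>" and Psi_ac: "\<forall>a. \<Psi> (to_ac a) = (to_ac \<circ> \<psi>) a"
    by (rule ring_map_alg_closure_extend)
  interpret Psi: ring_map \<Psi> by (rule Psi)
  have const: "\<Psi> (to_ac (to_fract [:c:])) = to_ac (to_fract [:c:])" for c
    by (simp add: Psi_ac psi_pc)
  have Psi_s: "\<Psi> ac_s = ac_s" using const[of "[:0, 1:]"] by (simp add: to_fract_s)
  have "pcompose [:0, 1:] q = [:0, 1:] * [:0, 1:] + [:[:0, 1:]:] * [:0, 1:]"
    by (simp add: pcompose_pCons q_def)
  then have "\<psi> var_t = var_t * var_t + var_s * var_t"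
    using psi_pc[of "[:0, 1:]"] by (simp only: to_fract_t to_fract_s to_fract_add to_fract_mult)
  then have "\<Psi> (to_ac var_t) = L (to_ac var_t)"
    by (simp add: Psi_ac L_def power2_eq_square)
  moreover have "\<Psi> (L x) = L (\<Psi> x)" for x using ring_map_Ln[OF Psi Psi_s, of 1] by simp
  moreover have "\<Psi> (G v) = 0" using v by simp
  \<comment> \<open>Applying \<open>\<Psi>\<close> to \<open>L v = t\<close> gives
    \<open>L (\<Psi> v) = L t\<close>, so \<open>\<Psi> v\<close> is \<open>t\<close> up to the
    kernel of \<open>L\<close>, which is 0 and \<open>s\<close>.\<close>
  ultimately have "L (\<Psi> v + to_ac var_t) = 0" by (simp add: G_def L_add)
  then have "\<Psi> v + to_ac var_t = 0 \<or> \<Psi> v + to_ac var_t = ac_s" by (simp only: L_eq_0)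
  moreover have "\<Psi> v = to_ac var_t + (\<Psi> v + to_ac var_t)" by (simp add: add.left_commute)
  ultimately have Psi_v: "\<Psi> v = to_ac var_t \<or> \<Psi> v = to_ac (var_t + var_s)"
    by (metis add_0_right to_ac_add)
  \<comment> \<open>\<open>t\<close> is the image of \<open>v\<close> or of \<open>v + s\<close>.
    With it the range contains the whole base field, which makes \<open>\<Psi>\<close>
    surjective.\<close>
  have t_range: "to_ac var_t \<in> range \<Psi>"
    using Psi_v
  proof
    assume "\<Psi> v = to_ac (var_t + var_s)"
    then have "\<Psi> (v + ac_s) = to_ac var_t" by (simp add: Psi_s add.assoc)
    then show ?thesis by (metis rangeI)
  qed (metis rangeI)
  have poly_range: "to_ac (to_fract p) \<in> range \<Psi>" for p
  proof (induction p)
    case 0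
    then show ?case by (metis Psi.map_zero rangeI to_ac_0 to_fract_0)
  next
    case (pCons c p)
    obtain x y where xy: "to_ac (to_fract p) = \<Psi> x" "to_ac var_t = \<Psi> y"
      using pCons.IH t_range by blast
    have "pCons c p = [:c:] + [:0, 1:] * p" by simp
    then have "to_fract (pCons c p) = to_fract [:c:] + var_t * to_fract p"
      by (simp only: to_fract_add to_fract_mult to_fract_t)
    then have "to_ac (to_fract (pCons c p)) = \<Psi> (to_ac (to_fract [:c:]) + y * x)"
      by (simp add: const xy)
    then show ?case by (metis rangeI)
  qed
  have "to_ac a \<in> range \<Psi>" for a
  proof -
    obtain n d where a: "a = Fract n d" by (cases a) auto
    obtain x y where xy: "to_ac (to_fract n) = \<Psi> x" "to_ac (to_fract d) = \<Psi> y"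
      using poly_range by blast
    have "\<Psi> (inverse y) = inverse (\<Psi> y)"
    proof (cases "y = 0")
      case False
      then have "\<Psi> y * \<Psi> (inverse y) = 1" by (simp flip: Psi.map_mult)
      then show ?thesis by (rule inverse_unique[symmetric])
    qed simp
    then have "to_ac a = \<Psi> (x * inverse y)"
      by (simp add: a Fract_conv_to_fract xy divide_inverse)
    then show ?thesis by (metis rangeI)
  qed
  then have "bij \<Psi>"
    using ring_map_inj[OF Psi] ring_map_alg_closure_surj[OF Psi] by (auto simp: bij_def)
  let ?\<Psi>' = "inv_into UNIV \<Psi>"
  have Psi': "ring_map ?\<Psi>'" using ring_map_inv[OF Psi \<open>bij \<Psi>\<close>] .
  have cancel: "?\<Psi>' (\<Psi> x) = x" for x using \<open>bij \<Psi>\<close> by (simp add: bij_is_inj)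
  have "(L ^^ j) (\<Psi> w) = ac_s" "(L ^^ j) (\<Psi> w') = ac_s"
    using w ring_map_Ln[OF Psi Psi_s] Psi_s by metis+
  then obtain \<tau> where tau: "\<tau> \<in> base_autos" "\<tau> (\<Psi> w) = \<Psi> w'"
    by (rule move_generator)
  \<comment> \<open>\<open>\<tau>\<close> fixes the base field, which contains
    \<open>\<Psi> v\<close> and the image under \<open>\<Psi>\<close> of the base field; so its
    conjugate fixes both \<open>v\<close> and the base field.\<close>
  show thesis
  proof
    show "?\<Psi>' \<circ> \<tau> \<circ> \<Psi> \<in> base_autos"
    proof (rule base_autosI)
      show "ring_map (?\<Psi>' \<circ> \<tau> \<circ> \<Psi>)"
        by (intro ring_map_comp Psi Psi' base_autos_ring_map tau)
      show "(?\<Psi>' \<circ> \<tau> \<circ> \<Psi>) (to_ac a) = to_ac a" for a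
        using cancel[of "to_ac a"] by (simp add: Psi_ac base_autos_fix[OF tau(1)])
    qed
    have "\<tau> (\<Psi> v) = \<Psi> v" using Psi_v base_autos_fix[OF tau(1)] by metis
    then show "(?\<Psi>' \<circ> \<tau> \<circ> \<Psi>) v = v" by (simp add: cancel)
    show "(?\<Psi>' \<circ> \<tau> \<circ> \<Psi>) w = w'" by (simp add: cancel tau)
  qed
qed

text \<open>\<open>v\<close> and \<open>v + s\<close> are both roots of the irreducible
  quadratic.\<close>

lemma move_root:
  assumes "G v = 0"
  obtains \<tau> where "\<tau> \<in> base_autos" "\<tau> v = v + ac_s"
proof -
  have "L ac_s = 0" by (simp add: L_eq_0)
  then have "G (v + ac_s) = 0" using assms by (simp add: G_def L_add)
  then show thesis
    using conjugate_by_base_auto[OF frakG_irreducible[where 'k='k], unfolded poly_frakG, OF assms] that by blast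
qed

lemma base_autos_agree:
  assumes "\<sigma> \<in> base_autos" "\<tau> \<in> base_autos" "(L ^^ m) w = ac_s" "\<sigma> w = \<tau> w" "x \<in> W (Suc m)"
  shows "\<sigma> x = \<tau> x"
proof -
  have "W (Suc m) \<subseteq> {x. \<sigma> x = \<tau> x}"
    by (rule W_subset_submodule[OF _ _ _ assms(3)])
      (use assms(1,2,4) in \<open>auto simp: base_autos_add base_autos_L\<close>)
  then show ?thesis using assms(5) by blast
qed

text \<open>The translations of \<open>r\<close> by automorphisms fixing \<open>w\<close> form a
  submodule \<open>T\<close>, so it suffices to find a generator of \<open>W (Suc m)\<close> in
  it.\<close>

lemma translations_full:
  assumes w: "(L ^^ m) w = ac_s" and r: "(G ^^ Suc m) r = 0" and b: "b \<in> W (Suc m)"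
  obtains \<sigma> where "\<sigma> \<in> base_autos" "\<sigma> w = w" "\<sigma> r = r + b"
proof -
  define T where "T = {b. \<exists>\<sigma>\<in>base_autos. \<sigma> w = w \<and> \<sigma> r = r + b}"
  have T_W: "b \<in> W (Suc m)" if "b \<in> T" for b
  proof -
    from that obtain \<sigma> where "\<sigma> \<in> base_autos" "\<sigma> r = r + b" by (auto simp: T_def)
    then have "(G ^^ Suc m) (r + b) = 0"
      using r base_autos_Gn[of \<sigma> "Suc m" r] base_autos_zero[of \<sigma>] by metis
    then show ?thesis using r unfolding Gn_add by (simp add: W_def)
  qed
  have id_base: "id \<in> (base_autos :: ('k rfun2 alg_closure \<Rightarrow> _) set)" by (simp add: base_autos_def)
  have fixW: "\<sigma> x = x" if "\<sigma> \<in> base_autos" "\<sigma> w = w" "x \<in> W (Suc m)" for \<sigma> x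
    using base_autos_agree[OF that(1) id_base w] that by simp
  have T_add: "b + c \<in> T" if bc: "b \<in> T" "c \<in> T" for b c
  proof -
    from bc obtain \<sigma> \<tau> where 1: "\<sigma> \<in> base_autos" "\<sigma> w = w" "\<sigma> r = r + b"
      and 2: "\<tau> \<in> base_autos" "\<tau> w = w" "\<tau> r = r + c"
      by (auto simp: T_def)
    have "(\<sigma> \<circ> \<tau>) r = r + (b + c)"
      using fixW[OF 1(1,2) T_W[OF bc(2)]] by (simp add: 1 2 base_autos_add add.assoc)
    then show ?thesis
      unfolding T_def using base_autos_comp[OF 1(1) 2(1)] 1 2
      by (intro CollectI bexI[of _ "\<sigma> \<circ> \<tau>"]) auto
  qed
  \<comment> \<open>Conjugation by some \<open>\<tau>\<close> acting on \<open>W (Suc m)\<close> as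
    \<open>1 + L\<close> turns the translation by \<open>b\<close> into the one by
    \<open>b + L b\<close>; adding \<open>b\<close> leaves \<open>L b\<close>.\<close>
  have T_L: "L b \<in> T" if b: "b \<in> T" for b
  proof -
    from b obtain \<sigma> where sig: "\<sigma> \<in> base_autos" "\<sigma> w = w" "\<sigma> r = r + b" by (auto simp: T_def)
    have "w \<in> W (Suc m)" using w by (simp add: W_Suc)
    then have "(L ^^ m) (L w) = 0" by (simp add: W_def flip: funpow_swap1)
    then have "(L ^^ m) (w + L w) = ac_s" using w by (simp add: Ln_add)
    then obtain \<tau> where tau: "\<tau> \<in> base_autos" "\<tau> w = w + L w" using move_generator[OF w] by metis
    have bij: "bij \<tau>" using tau(1) by (rule base_autos_bij)
    let ?\<tau>' = "inv_into UNIV \<tau>"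
    have tau': "?\<tau>' \<in> base_autos" using base_autos_inv[OF tau(1)] .
    have canc: "\<tau> (?\<tau>' x) = x" for x using bij by (simp add: bij_is_surj surj_f_inv_f)
    have "?\<tau>' w \<in> W (Suc m)" using base_autos_W[OF tau' \<open>w \<in> W (Suc m)\<close>] .
    then have fw: "(\<tau> \<circ> \<sigma> \<circ> ?\<tau>') w = w" using fixW[OF sig(1,2)] canc by simp
    \<comment> \<open>\<open>?\<tau>' r\<close> is again a root, so \<open>c\<close> lies in
      \<open>W (Suc m)\<close> and is fixed by \<open>\<sigma>\<close>. Hence
      \<open>\<sigma>\<close> moves \<open>?\<tau>' r\<close> by the same \<open>b\<close> as
      \<open>r\<close>.\<close>
    define c where "c = r + ?\<tau>' r"
    have "(G ^^ Suc m) (?\<tau>' r) = 0"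
      using r base_autos_Gn[OF tau', of "Suc m" r] base_autos_zero[OF tau'] by metis
    then have "(G ^^ Suc m) (r + c) = 0" by (simp add: c_def del: funpow.simps)
    then have "c \<in> W (Suc m)" using r unfolding Gn_add by (simp add: W_def)
    then have "\<sigma> (?\<tau>' r) = ?\<tau>' r + b"
      using fixW[OF sig(1,2), of c] base_autos_add[OF sig(1), of r c] sig(3)
      by (simp add: c_def add.commute add.left_commute)
    then have "(\<tau> \<circ> \<sigma> \<circ> ?\<tau>') r = r + \<tau> b" using base_autos_add[OF tau(1)] canc by simp
    then have "\<tau> b \<in> T"
      unfolding T_def using base_autos_comp[OF base_autos_comp[OF tau(1) sig(1)] tau'] fw by blast
    moreover have "\<tau> b = b + L b"
    proof -
      have "W (Suc m) \<subseteq> {x. \<tau> x = x + L x}"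
        by (rule W_subset_submodule[OF _ _ _ w])
          (use tau in \<open>auto simp: base_autos_add base_autos_L L_add algebra_simps\<close>)
      then show ?thesis using T_W[OF b] by blast
    qed
    ultimately show ?thesis using T_add[OF b, of "b + L b"] by simp
  qed
  \<comment> \<open>For the generator, start with \<open>\<tau>\<close> moving \<open>v\<close> to
    \<open>v + s\<close>. It may also move \<open>w\<close>; undoing this by some
    \<open>\<sigma>\<close> that fixes \<open>v\<close> gives \<open>\<rho>\<close>, which fixes
    \<open>w\<close> and displaces \<open>r\<close> by an \<open>e\<close> with
    \<open>(L ^^ m) e = s\<close>.\<close>
  define v where "v = (G ^^ m) r"
  have Gv: "G v = 0" using r by (simp add: v_def)
  obtain \<tau> where tau: "\<tau> \<in> base_autos" "\<tau> v = v + ac_s" using move_root[OF Gv] .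
  have "(L ^^ m) (\<tau> w) = ac_s"
    using w base_autos_Ln[OF tau(1), of m w] base_autos_fix[OF tau(1)] by metis
  then obtain \<sigma> where sig: "\<sigma> \<in> base_autos" "\<sigma> v = v" "\<sigma> w = \<tau> w"
    using move_generator_fixing_root[OF Gv w] by metis
  let ?\<sigma>' = "inv_into UNIV \<sigma>"
  have sig': "?\<sigma>' \<in> base_autos" using base_autos_inv[OF sig(1)] .
  have canc: "?\<sigma>' (\<sigma> x) = x" for x using base_autos_bij[OF sig(1)] by (simp add: bij_is_inj)
  define \<rho> where "\<rho> = ?\<sigma>' \<circ> \<tau>"
  have rho: "\<rho> \<in> base_autos" unfolding \<rho>_def by (rule base_autos_comp[OF sig' tau(1)])
  have rho_w: "\<rho> w = w" using canc[of w] by (simp add: \<rho>_def sig(3))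
  have rho_v: "\<rho> v = v + ac_s"
    using canc[of v] by (simp add: \<rho>_def tau(2) base_autos_add[OF sig'] base_autos_fix[OF sig'] sig(2))
  define e where "e = r + \<rho> r"
  have "e \<in> T" unfolding T_def e_def using rho rho_w by auto
  moreover have "(L ^^ m) e = ac_s"
  proof -
    have "\<rho> v = (G ^^ m) (r + e)" by (simp add: v_def base_autos_Gn[OF rho] e_def)
    also have "\<dots> = v + (L ^^ m) e" by (simp add: Gn_add v_def)
    finally show ?thesis using rho_v by simp
  qed
  ultimately have "W (Suc m) \<subseteq> T" using W_subset_submodule[of T e m] T_add T_L by blast
  then show thesis using b that by (auto simp: T_def)
qed

text \<open>Compose an automorphism \<open>\<sigma>\<close> taking \<open>w\<close> to
  \<open>w'\<close> with a preceding translation that fixes \<open>w\<close> and takes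
  \<open>r\<close> to the preimage of \<open>r'\<close> under \<open>\<sigma>\<close>.\<close>

lemma galois_full:
  assumes w: "(L ^^ m) w = ac_s" "(L ^^ m) w' = ac_s"
    and r: "(G ^^ Suc m) r = 0" "(G ^^ Suc m) r' = 0"
  obtains \<sigma> where "\<sigma> \<in> base_autos" "\<sigma> w = w'" "\<sigma> r = r'"
proof -
  obtain \<sigma> where sig: "\<sigma> \<in> base_autos" "\<sigma> w = w'" using move_generator[OF w] .
  let ?\<sigma>' = "inv_into UNIV \<sigma>"
  have sig': "?\<sigma>' \<in> base_autos" using base_autos_inv[OF sig(1)] .
  have canc: "\<sigma> (?\<sigma>' x) = x" for x
    using base_autos_bij[OF sig(1)] by (simp add: bij_is_surj surj_f_inv_f)
  have "(G ^^ Suc m) (?\<sigma>' r') = 0"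
    using r(2) base_autos_Gn[OF sig', of "Suc m" r'] base_autos_zero[OF sig'] by metis
  then have "(G ^^ Suc m) (r + (r + ?\<sigma>' r')) = 0" by (simp del: funpow.simps)
  then have "r + ?\<sigma>' r' \<in> W (Suc m)" using r(1) unfolding Gn_add[of _ r] by (simp add: W_def)
  then obtain \<tau> where tau: "\<tau> \<in> base_autos" "\<tau> w = w" "\<tau> r = r + (r + ?\<sigma>' r')"
    by (rule translations_full[OF w(1) r(1)])
  show thesis
    by (rule that[of "\<sigma> \<circ> \<tau>"]) (use tau sig canc base_autos_comp in auto)
qed

text \<open>The displacements at \<open>w\<close> and \<open>r\<close> determine a group element and
  range independently over \<open>W m\<close> and \<open>W (Suc m)\<close>. A root is fixed exactly
  when the second displacement lies in \<open>cyc\<close> of the first.\<close>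

lemma FPP_Gal_iter_Suc:
  "FPP (Gal_iter (Suc m) :: ('k rfun2 alg_closure \<Rightarrow> 'k rfun2 alg_closure) set) (iter_roots (Suc m))
     = (2 * 4 ^ m + 1) / (6 * 4 ^ m)"
proof -
  let ?n = "Suc m"
  define Z where "Z = (iter_roots ?n :: 'k rfun2 alg_closure set)"
  define Gal where "Gal = (Gal_iter ?n :: ('k rfun2 alg_closure \<Rightarrow> 'k rfun2 alg_closure) set)"
  obtain w where w: "(L ^^ m) w = ac_s" using Ln_surj by blast
  obtain r where r: "(G ^^ ?n) r = 0" using Gn_surj by blast
  have wW: "w \<in> W ?n" using w by (simp add: W_Suc)
  have Z_iff: "x \<in> Z \<longleftrightarrow> r + x \<in> W ?n" for x
  proof -
    have "(G ^^ ?n) (r + (r + x)) = (L ^^ ?n) (r + x)" unfolding Gn_add[of _ r] r by simp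
    then show ?thesis by (simp add: Z_def iter_roots_eq W_def del: funpow.simps)
  qed
  have rZ: "r \<in> Z" "r + w \<in> Z" using wW by (simp_all add: Z_iff)
  have Gal_eq: "Gal = (\<lambda>\<sigma>. restrict \<sigma> Z) ` base_autos" by (simp add: Gal_def Gal_iter_def Z_def)
  \<comment> \<open>\<open>w\<close> need not be a root, and outside the roots
    \<open>restrict\<close> yields \<open>undefined\<close>; so the displacement at \<open>w\<close>
    is read off from the roots \<open>r\<close> and \<open>r + w\<close>.\<close>
  define \<Theta> where "\<Theta> = (\<lambda>g. (g (r + w) + g r + w, g r + r))"
  have Theta: "\<Theta> (restrict \<sigma> Z) = (\<sigma> w + w, \<sigma> r + r)" if "\<sigma> \<in> base_autos" for \<sigma>
    using rZ base_autos_add[OF that, of r w]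
    by (simp add: \<Theta>_def add.assoc add.left_commute)
  have sW: "\<sigma> w + w \<in> W m" "\<sigma> r + r \<in> W ?n" if "\<sigma> \<in> base_autos" for \<sigma>
  proof -
    \<comment> \<open>The level is \<open>m\<close>, not \<open>Suc m\<close>:
      \<open>\<sigma> w\<close> and \<open>w\<close> have the same image \<open>s\<close> under
      \<open>L ^^ m\<close>.\<close>
    show "\<sigma> w + w \<in> W m"
      using w base_autos_Ln[OF that, of m w] base_autos_fix[OF that, of var_s]
      by (simp add: W_def Ln_add)
    have "(G ^^ ?n) (\<sigma> r) = 0"
      using r base_autos_Gn[OF that, of ?n r] base_autos_zero[OF that] by metis
    then have "\<sigma> r \<in> Z" by (simp add: Z_def iter_roots_eq del: funpow.simps)
    then show "\<sigma> r + r \<in> W ?n" by (simp add: Z_iff add.commute)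
  qed
  have inj: "inj_on \<Theta> Gal"
  proof (rule inj_onI)
    fix g g' assume "g \<in> Gal" "g' \<in> Gal" and eq: "\<Theta> g = \<Theta> g'"
    then obtain \<sigma> \<tau> where st: "\<sigma> \<in> base_autos" "\<tau> \<in> base_autos" and g: "g = restrict \<sigma> Z" "g' = restrict \<tau> Z"
      by (auto simp: Gal_eq)
    have "\<sigma> w = \<tau> w" "\<sigma> r = \<tau> r" using eq st by (simp_all add: g Theta)
    have "\<sigma> x = \<tau> x" if "x \<in> Z" for x
    proof -
      have "\<sigma> (r + x) = \<tau> (r + x)"
        using base_autos_agree[OF st w \<open>\<sigma> w = \<tau> w\<close>] that by (simp add: Z_iff)
      then show ?thesis using \<open>\<sigma> r = \<tau> r\<close> st by (simp add: base_autos_add)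
    qed
    then show "g = g'" by (auto simp: g restrict_def)
  qed
  have ex: "\<exists>\<sigma>\<in>base_autos. \<sigma> w + w = e \<and> \<sigma> r + r = b" if "e \<in> W m" "b \<in> W ?n" for e b
  proof -
    have "(L ^^ m) (w + e) = ac_s" using that(1) w by (simp add: Ln_add W_def)
    moreover have "(G ^^ ?n) (r + b) = 0" using that(2) r unfolding Gn_add by (simp add: W_def)
    ultimately obtain \<sigma> where "\<sigma> \<in> base_autos" "\<sigma> w = w + e" "\<sigma> r = r + b"
      using galois_full[OF w _ r] by metis
    then show ?thesis by (intro bexI[of _ \<sigma>]) (simp_all add: add.commute)
  qed
  have image: "\<Theta> ` Gal = W m \<times> W ?n"
  proof (intro equalityI subsetI)
    fix z assume "z \<in> \<Theta> ` Gal"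
    then show "z \<in> W m \<times> W ?n" using sW by (auto simp: Gal_eq Theta)
  next
    fix z assume "z \<in> W m \<times> W ?n"
    then obtain \<sigma> where "\<sigma> \<in> base_autos" "\<sigma> w + w = fst z" "\<sigma> r + r = snd z"
      using ex[of "fst z" "snd z"] by auto
    then have "z = \<Theta> (restrict \<sigma> Z)" "restrict \<sigma> Z \<in> Gal" by (auto simp: Theta Gal_eq)
    then show "z \<in> \<Theta> ` Gal" by blast
  qed
  have fixed_iff: "(\<exists>x\<in>Z. \<sigma> x = x) \<longleftrightarrow> \<sigma> r + r \<in> cyc (\<sigma> w + w)" if sig: "\<sigma> \<in> base_autos" for \<sigma>
  proof -
    have "\<sigma> w + w \<in> W ?n" using sW(1)[OF sig] W_Suc_subset by blast
    then have "(\<lambda>x. \<sigma> x + x) ` W ?n = cyc (\<sigma> w + w)"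
      by (intro image_plus_id base_autos_add base_autos_L sig w)
    \<comment> \<open>Every root is \<open>r + y\<close> with \<open>y\<close> in
      \<open>W ?n\<close>, and it is fixed when \<open>r\<close> and \<open>y\<close> have equal
      displacements.\<close>
    moreover have "(\<exists>x\<in>Z. \<sigma> x = x) \<longleftrightarrow> (\<exists>y\<in>W ?n. \<sigma> r + r = \<sigma> y + y)"
    proof
      assume "\<exists>x\<in>Z. \<sigma> x = x"
      then obtain x where x: "x \<in> Z" "\<sigma> x = x" by blast
      then have "\<sigma> r + r = \<sigma> (r + x) + (r + x)"
        by (simp add: base_autos_add[OF sig] add.assoc add.left_commute)
      then show "\<exists>y\<in>W ?n. \<sigma> r + r = \<sigma> y + y" using x(1) Z_iff by blast
    next
      assume "\<exists>y\<in>W ?n. \<sigma> r + r = \<sigma> y + y"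
      then obtain y where y: "y \<in> W ?n" "\<sigma> r + r = \<sigma> y + y" by blast
      have "\<sigma> (r + y) + (r + y) = (\<sigma> r + r) + (\<sigma> y + y)"
        by (simp add: base_autos_add[OF sig] add.assoc add.left_commute)
      then have "\<sigma> (r + y) = r + y" unfolding y(2) by simp
      moreover have "r + y \<in> Z" using y(1) by (simp add: Z_iff)
      ultimately show "\<exists>x\<in>Z. \<sigma> x = x" by blast
    qed
    ultimately show ?thesis by auto
  qed
  have fixed_image: "\<Theta> ` {g \<in> Gal. \<exists>x\<in>Z. g x = x} = Sigma (W m) cyc"
  proof (intro equalityI subsetI)
    fix z assume "z \<in> \<Theta> ` {g \<in> Gal. \<exists>x\<in>Z. g x = x}"
    then obtain g where g: "g \<in> Gal" "\<exists>x\<in>Z. g x = x" "z = \<Theta> g" by blast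
    then obtain \<sigma> where sig: "\<sigma> \<in> base_autos" "g = restrict \<sigma> Z" unfolding Gal_eq by blast
    moreover have "\<exists>x\<in>Z. \<sigma> x = x" using g(2) by (auto simp: sig)
    ultimately show "z \<in> Sigma (W m) cyc" using fixed_iff sW(1) g(3) by (simp add: Theta)
  next
    fix z assume z: "z \<in> Sigma (W m) cyc"
    then have "fst z \<in> W m" "snd z \<in> W ?n" using cyc_subset W_Suc_subset[of m] by fastforce+
    then obtain \<sigma> where sig: "\<sigma> \<in> base_autos" "\<sigma> w + w = fst z" "\<sigma> r + r = snd z"
      using ex by blast
    then have "\<exists>x\<in>Z. restrict \<sigma> Z x = x" using fixed_iff[OF sig(1)] z by auto
    moreover have "restrict \<sigma> Z \<in> Gal" using sig(1) by (auto simp: Gal_eq)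
    moreover have "z = \<Theta> (restrict \<sigma> Z)" using sig by (simp add: Theta)
    ultimately show "z \<in> \<Theta> ` {g \<in> Gal. \<exists>x\<in>Z. g x = x}" by blast
  qed
  have "card Gal = card (W m \<times> W ?n)" using card_image[OF inj] image by simp
  also have "\<dots> = 2 * (2 ^ m * 2 ^ m)" using card_W by (simp add: card_cartesian_product)
  also have "(2::nat) ^ m * 2 ^ m = 4 ^ m" by (simp flip: power_mult_distrib)
  finally have card_Gal: "card Gal = 2 * 4 ^ m" .
  have "inj_on \<Theta> {g \<in> Gal. \<exists>x\<in>Z. g x = x}" using inj by (rule inj_on_subset) auto
  then have "card {g \<in> Gal. \<exists>x\<in>Z. g x = x} = card (Sigma (W m) cyc)"
    unfolding fixed_image[symmetric] by (rule card_image[symmetric])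
  moreover have "real (3 * card (Sigma (W m) cyc)) = real (2 * 4 ^ m + 1)"
    by (simp only: card_Sigma_cyc)
  ultimately have "3 * real (card {g \<in> Gal. \<exists>x\<in>Z. g x = x}) = 2 * 4 ^ m + 1" by simp
  then have card_fixed: "real (card {g \<in> Gal. \<exists>x\<in>Z. g x = x}) = (2 * 4 ^ m + 1) / 3" by simp
  have "FPP Gal Z = (2 * 4 ^ m + 1) / 3 / (2 * 4 ^ m)"
    unfolding FPP_def card_Gal card_fixed by simp
  then show ?thesis by (simp add: Gal_def Z_def)
qed

end

theorem theorem5p4:
  assumes "CHAR('k::field) = 2"
  shows "(\<lambda>n. FPP (Gal_iter n :: ('k rfun2 alg_closure \<Rightarrow> 'k rfun2 alg_closure) set)
                  (iter_roots n)) \<longlonglongrightarrow> 1 / 3"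
proof -
  have "(\<lambda>m. 1 / 3 + 1 / 6 * (1 / 4) ^ m) \<longlonglongrightarrow> 1 / 3 + 1 / 6 * (0 :: real)"
    by (intro tendsto_intros LIMSEQ_power_zero) simp
  moreover have "(2 * 4 ^ m + 1) / (6 * 4 ^ m) = 1 / 3 + 1 / 6 * (1 / 4 :: real) ^ m" for m
    by (simp add: field_simps power_divide)
  ultimately have "(\<lambda>m. FPP (Gal_iter (Suc m) :: ('k rfun2 alg_closure \<Rightarrow> 'k rfun2 alg_closure) set)
      (iter_roots (Suc m))) \<longlonglongrightarrow> 1 / 3"
    by (simp add: FPP_Gal_iter_Suc[OF assms])
  \<comment> \<open>The closed form is for a positive number of iterations; shifting the index does
    not affect the limit.\<close>
  then show ?thesis by (rule LIMSEQ_imp_Suc)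
qed

end
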